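(* Let $\{(X^k,Y^k,S^k)\}$ be the sequence generated by the JA-PG algorithm for problem (FB). Then any accumulation point of $\{(X^k,Y^k,S^k)\}$ is a stationary point of problem (FB). Moreover, when $\lambda>0$ and $\tau=+\infty$ in problem (FB), for any accumulation point $(X^*,Y^*,S^* )$ of $\{(X^k,Y^k,S^k)\}$, the pair $(X^*{Y^*}^{\mathbb{T}},S^* )$ is a stationary point of problem (L).
   Context: Let $m,n,d$ be positive integers, $\lambda,\beta\ge 0$, $\tau\in[0,+\infty]$, and let $f:\mathbb{R}^{m\times n}\times\mathbb{R}^{m\times n}\to[0,+\infty)$, $(Z,S)\mapsto f(Z,S)$, be differentiable with locally Lipschitz continuous gradient. $\|S\|_0$ is the number of nonzero entries of $S$; $\mathrm{nnzc}(X)$ the number of nonzero columns of $X$; $U_i$ the $i$-th column of $U$; $\delta_\Omega$ the indicator function of $\Omega$ ($0$ on $\Omega$, $+\infty$ off $\Omega$). Let $\mathcal{B}^X:=\{X\in\mathbb{R}^{m\times d}:\|X_i\|_2\le\tau\ \forall i\}$, $\mathcal{B}^Y:=\{Y\in\mathbb{R}^{n\times d}:\|Y_i\|_2\le\tau\ \forall i\}$, $\mathcal{B}^S:=\{S\in\mathbb{R}^{m\times n}:\kappa^1_{ij}\le S_{ij}\le\kappa^2_{ij}\ \forall i,j\}$ with given $\kappa^1_{ij}\in[-\infty,0]$, $\kappa^2_{ij}\in[0,+\infty]$, $\mathcal{B}:=\mathcal{B}^X\times\mathcal{B}^Y\times\mathcal{B}^S$. Problem (FB): minimize $F(X,Y,S):=f(XY^{\mathbb{T}},S)+\lambda(\mathrm{nnzc}(X)+\mathrm{nnzc}(Y))+\beta\|S\|_0$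 over $\mathcal{B}$. Problem (L): minimize $f(Z,S)+2\lambda\,\mathrm{rank}(Z)+\beta\|S\|_0$ over $(Z,S)\in\mathbb{R}^{m\times n}\times\mathcal{B}^S$ with $\mathrm{rank}(Z)\le d$. $N_\Omega$ is the limiting normal cone (Rockafellar–Wets). Index sets: for $U$ with $d$ columns, $\mathbb{I}_U:=\{i\in[d]:U_i\ne\bm 0\}$ if $\lambda>0$, $\mathbb{I}_U:=[d]$ if $\lambda=0$; for $S\in\mathbb{R}^{m\times n}$, $\mathbb{J}_S:=\{(i,j):S_{ij}\neq0\}$ if $\beta>0$, $\mathbb{J}_S:=[m]\times[n]$ if $\beta=0$. $\underline{\mathcal{B}}^X_{\mathbb{I}}$, $\underline{\mathcal{B}}^Y_{\mathbb{I}}$ are obtained from $\mathcal{B}^X,\mathcal{B}^Y$ by setting to zero all columns outside $\mathbb{I}$, and $\underline{\mathcal{B}}^S_{\mathbb{J}}$ from $\mathcal{B}^S$ by setting to zero all entries outside $\mathbb{J}$. Stationary point of (FB): $(\bar X,\bar Y,\bar S)\in\mathcal{B}$ such that, with $H_Z=\nabla_Zf(\bar X\bar Y^{\mathbb{T}},\bar S)$ and $H_S=\nabla_Sf(\bar X\bar Y^{\mathbb{T}},\bar S)$, $\bm 0\in H_Z\bar Y+N_{\underline{\mathcal{B}}^X_{\mathbb{I}_{\bar X}}}(\bar X)$, $\bm 0\in H_Z^{\mathbb{T}}\bar X+N_{\underline{\mathcal{B}}^Y_{\mathbb{I}_{\bar Y}}}(\bar Y)$, $\bm 0\in H_S+N_{\underline{\mathcal{B}}^S_{\mathbb{J}_{\bar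 S}}}(\bar S)$. Stationary point of (L): $(\bar Z,\bar S)\in\mathbb{R}^{m\times n}\times\mathcal{B}^S$ with $\mathrm{rank}(\bar Z)\le d$, $-\nabla_Zf(\bar Z,\bar S)\in N_{\mathcal{M}_{\lambda,\bar Z}}(\bar Z)$ and $-\nabla_Sf(\bar Z,\bar S)\in N_{\underline{\mathcal{B}}^S_{\mathbb{J}_{\bar S}}}(\bar S)$, where $\mathcal{M}_{\lambda,\bar Z}:=\{Z\in\mathbb{R}^{m\times n}:\mathrm{rank}(Z)\le d,\ \lambda\,\mathrm{rank}(Z)=\lambda\,\mathrm{rank}(\bar Z)\}$. JA-PG algorithm for (FB). Put $P(X):=\lambda\,\mathrm{nnzc}(X)+\delta_{\mathcal{B}^X}(X)$, $Q(Y):=\lambda\,\mathrm{nnzc}(Y)+\delta_{\mathcal{B}^Y}(Y)$, $R(S):=\beta\|S\|_0+\delta_{\mathcal{B}^S}(S)$, and $f_J(X,Y;\bar S):=f(XY^{\mathbb{T}},\bar S)+P(X)+Q(Y)$; $f_A(S;\bar X,\bar Y):=f(\bar X\bar Y^{\mathbb{T}},S)+R(S)$; $\omega_J(X,Y;\bar X,\bar Y,\bar S,\iota_1,\iota_2):=P(X)+Q(Y)+\langle\nabla_Zf(\bar X\bar Y^{\mathbb{T}},\bar S)\bar Y,X-\bar X\rangle+\langle\nabla_Zf(\bar X\bar Y^{\mathbb{T}},\bar S)^{\mathbb{T}}\bar X,Y-\bar Y\rangle+\frac{\iota_1}{2}\|X-\bar X\|_F^2+\frac{\iota_2}{2}\|Y-\bar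 Y\|_F^2$; $\omega_A(S;\bar X,\bar Y,\bar S,\iota):=R(S)+\langle\nabla_Sf(\bar X\bar Y^{\mathbb{T}},\bar S),S-\bar S\rangle+\frac{\iota}{2}\|S-\bar S\|_F^2$. Choose $(X^0,Y^0,S^0)\in\mathcal{B}$, $0<\underline\iota\le\overline\iota$, $0<c_{\min}\le c_{\max}$, $\varrho>1$, sequences $\{\iota^B_{1,k}\},\{\iota^B_{2,k}\},\{\iota^B_k\}\subseteq[\underline\iota,\overline\iota]$ and $\{c_{1,k}\},\{c_{2,k}\}\subseteq[c_{\min},c_{\max}]$. For $k=0,1,2,\dots$: Step 1: for $l=1,2,\dots$ set $\iota_{1,k}=\iota^B_{1,k}\varrho^{l-1}$, $\iota_{2,k}=\iota^B_{2,k}\varrho^{l-1}$, compute some $(X^+,Y^+)\in\mathrm{argmin}_{(X,Y)}\,\omega_J(X,Y;X^k,Y^k,S^k,\iota_{1,k},\iota_{2,k})$; as soon as $f_J(X^+,Y^+;S^k)\le f_J(X^k,Y^k;S^k)-\frac{c_{1,k}}{2}\|(X^+,Y^+)-(X^k,Y^k)\|_F^2$, stop the inner loop and set $(X^{k+1},Y^{k+1})=(X^+,Y^+)$. Step 2: for $l=1,2,\dots$ set $\iota_k=\iota^B_k\varrho^{l-1}$, compute some $S^+\in\mathrm{argmin}_S\,\omega_A(S;X^{k+1},Y^{k+1},S^k,\iota_k)$; as soon as $f_A(S^+;X^{k+1},Y^{k+1})\le f_A(S^k;X^{k+1},Y^{k+1})-\frac{c_{2,k}}{2}\|S^+-S^k\|_F^2$,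 stop the inner loop and set $S^{k+1}=S^+$. *)

theory Defs
  imports "HOL-Analysis.Analysis"
begin

(* An m x n real matrix has type real^'n^'m.  On this type the library's norm and inner product
   are the Frobenius norm and the Frobenius inner product; the norm of a pair is
   norm (A, B) = sqrt (norm A ^ 2 + norm B ^ 2). *)

section \<open>Variational notions\<close>

(* Meaningful at points of differentiability; see GDERIV_grad. *)
definition grad :: "('a::real_inner \<Rightarrow> real) \<Rightarrow> 'a \<Rightarrow> 'a" where
  "grad f x = (THE D. GDERIV f x :> D)"

lemma grad_eqI:
  fixes f :: "'a::real_inner \<Rightarrow> real"
  assumes "GDERIV f x :> D"
  shows "grad f x = D"
  unfolding grad_def
proof (rule the_equality)
  fix D' assume "GDERIV f x :> D'"
  with assms have "(\<lambda>h. inner h D') = (\<lambda>h. inner h D)"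
    unfolding gderiv_def by (rule has_derivative_unique[rotated])
  then have "inner (D' - D) D' = inner (D' - D) D"
    by metis
  then have "inner (D' - D) (D' - D) = 0"
    by (simp add: inner_diff_right)
  then show "D' = D"
    by simp
qed (fact assms)

lemma GDERIV_grad:
  fixes f :: "'a::euclidean_space \<Rightarrow> real"
  assumes "f differentiable (at x)"
  shows "GDERIV f x :> grad f x"
proof -
  obtain f' where f': "(f has_derivative f') (at x)"
    using assms unfolding differentiable_def by blast
  interpret linear f'
    using f' by (rule has_derivative_linear)
  have "f' h = inner h (\<Sum>b\<in>Basis. f' b *\<^sub>R b)" for h
  proof -
    have "f' h = f' (\<Sum>b\<in>Basis. inner h b *\<^sub>R b)"
      by (simp add: euclidean_representation)
    also have "\<dots> = (\<Sum>b\<in>Basis. inner h b * f' b)"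
      by (simp add: sum scale)
    also have "\<dots> = inner h (\<Sum>b\<in>Basis. f' b *\<^sub>R b)"
      by (simp add: inner_sum_right mult.commute)
    finally show ?thesis .
  qed
  then have "GDERIV f x :> (\<Sum>b\<in>Basis. f' b *\<^sub>R b)"
    unfolding gderiv_def using f' by (metis (no_types, lifting) ext)
  then show ?thesis
    using grad_eqI by metis
qed

definition locally_lipschitz :: "('a::metric_space \<Rightarrow> 'b::metric_space) \<Rightarrow> bool" where
  "locally_lipschitz g \<longleftrightarrow> (\<forall>x. \<exists>u>0. \<exists>L. L-lipschitz_on (ball x u) g)"

definition ind_fun :: "'a set \<Rightarrow> 'a \<Rightarrow> ereal" where
  "ind_fun \<Omega> x = (if x \<in> \<Omega> then 0 else \<infinity>)"

(* Rockafellar-Wets, Variational Analysis, Definition 6.3: regular normals, then limiting normals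
   as limits of regular normals at points of C tending to x. *)
definition regular_normal_cone :: "'a::euclidean_space set \<Rightarrow> 'a \<Rightarrow> 'a set" where
  "regular_normal_cone C x =
     {v. x \<in> C \<and> (\<forall>e>0. \<forall>\<^sub>F y in at x within C. inner v (y - x) \<le> e * norm (y - x))}"

definition normal_cone :: "'a::euclidean_space set \<Rightarrow> 'a \<Rightarrow> 'a set" where
  "normal_cone C x =
     {v. x \<in> C \<and> (\<exists>xs vs. xs \<longlonglongrightarrow> x \<and> vs \<longlonglongrightarrow> v \<and>
            (\<forall>k. xs k \<in> C \<and> vs k \<in> regular_normal_cone C (xs k)))}"

definition accumulation_point :: "(nat \<Rightarrow> 'a::topological_space) \<Rightarrow> 'a \<Rightarrow> bool" where
  "accumulation_point s x \<longleftrightarrow> (\<exists>r::nat \<Rightarrow> nat. strict_mono r \<and> (s \<circ> r) \<longlonglongrightarrow> x)"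


section \<open>Sparsity, constraint sets and index sets\<close>

definition nnzc :: "real^'d^'k \<Rightarrow> nat" where
  "nnzc U = card {i. column i U \<noteq> 0}"

definition norm0 :: "real^'n^'m \<Rightarrow> nat" where
  "norm0 S = card {(i, j). S $ i $ j \<noteq> 0}"

definition col_ball :: "ereal \<Rightarrow> (real^'d^'k) set" where
  "col_ball \<tau> = {U. \<forall>i. ereal (norm (column i U)) \<le> \<tau>}"

definition box_set :: "ereal^'n^'m \<Rightarrow> ereal^'n^'m \<Rightarrow> (real^'n^'m) set" where
  "box_set \<kappa>1 \<kappa>2 =
     {S. \<forall>i j. \<kappa>1 $ i $ j \<le> ereal (S $ i $ j) \<and> ereal (S $ i $ j) \<le> \<kappa>2 $ i $ j}"

definition idx_cols :: "real \<Rightarrow> real^'d^'k \<Rightarrow> 'd set" where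
  "idx_cols lam U = (if lam > 0 then {i. column i U \<noteq> 0} else UNIV)"

definition idx_entries :: "real \<Rightarrow> real^'n^'m \<Rightarrow> ('m \<times> 'n) set" where
  "idx_entries \<beta> S = (if \<beta> > 0 then {(i, j). S $ i $ j \<noteq> 0} else UNIV)"

definition col_ball_on :: "ereal \<Rightarrow> 'd set \<Rightarrow> (real^'d^'k) set" where
  "col_ball_on \<tau> I = {U \<in> col_ball \<tau>. \<forall>i. i \<notin> I \<longrightarrow> column i U = 0}"

definition box_set_on ::
    "ereal^'n^'m \<Rightarrow> ereal^'n^'m \<Rightarrow> ('m \<times> 'n) set \<Rightarrow> (real^'n^'m) set" where
  "box_set_on \<kappa>1 \<kappa>2 J = {S \<in> box_set \<kappa>1 \<kappa>2. \<forall>i j. (i, j) \<notin> J \<longrightarrow> S $ i $ j = 0}"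


section \<open>Stationary points\<close>

definition grad_Z ::
    "((real^'n^'m) \<times> (real^'n^'m) \<Rightarrow> real) \<Rightarrow> real^'n^'m \<Rightarrow> real^'n^'m \<Rightarrow> real^'n^'m" where
  "grad_Z f Z S = grad (\<lambda>Z'. f (Z', S)) Z"

definition grad_S ::
    "((real^'n^'m) \<times> (real^'n^'m) \<Rightarrow> real) \<Rightarrow> real^'n^'m \<Rightarrow> real^'n^'m \<Rightarrow> real^'n^'m" where
  "grad_S f Z S = grad (\<lambda>S'. f (Z, S')) S"

definition stationary_FB ::
    "((real^'n^'m) \<times> (real^'n^'m) \<Rightarrow> real) \<Rightarrow> real \<Rightarrow> real \<Rightarrow> ereal \<Rightarrow> ereal^'n^'m \<Rightarrow> ereal^'n^'m
      \<Rightarrow> real^'d^'m \<Rightarrow> real^'d^'n \<Rightarrow> real^'n^'m \<Rightarrow> bool" where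
  "stationary_FB f lam \<beta> \<tau> \<kappa>1 \<kappa>2 X Y S \<longleftrightarrow>
     (X, Y, S) \<in> col_ball \<tau> \<times> col_ball \<tau> \<times> box_set \<kappa>1 \<kappa>2 \<and>
     (let HZ = grad_Z f (X ** transpose Y) S; HS = grad_S f (X ** transpose Y) S in
        0 \<in> (+) (HZ ** Y) ` normal_cone (col_ball_on \<tau> (idx_cols lam X)) X \<and>
        0 \<in> (+) (transpose HZ ** X) ` normal_cone (col_ball_on \<tau> (idx_cols lam Y)) Y \<and>
        0 \<in> (+) HS ` normal_cone (box_set_on \<kappa>1 \<kappa>2 (idx_entries \<beta> S)) S)"

definition rank_set :: "real \<Rightarrow> nat \<Rightarrow> real^'n^'m \<Rightarrow> (real^'n^'m) set" where
  "rank_set lam d Zb = {Z. rank Z \<le> d \<and> lam * real (rank Z) = lam * real (rank Zb)}"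

definition stationary_L ::
    "((real^'n^'m) \<times> (real^'n^'m) \<Rightarrow> real) \<Rightarrow> real \<Rightarrow> real \<Rightarrow> nat \<Rightarrow> ereal^'n^'m \<Rightarrow> ereal^'n^'m
      \<Rightarrow> real^'n^'m \<Rightarrow> real^'n^'m \<Rightarrow> bool" where
  "stationary_L f lam \<beta> d \<kappa>1 \<kappa>2 Z S \<longleftrightarrow>
     S \<in> box_set \<kappa>1 \<kappa>2 \<and> rank Z \<le> d \<and>
     - grad_Z f Z S \<in> normal_cone (rank_set lam d Z) Z \<and>
     - grad_S f Z S \<in> normal_cone (box_set_on \<kappa>1 \<kappa>2 (idx_entries \<beta> S)) S"


section \<open>The JA-PG iteration\<close>

(* The regularizer of both factors: P for real^'d^'m and Q for real^'d^'n. *)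
definition reg_cols :: "real \<Rightarrow> ereal \<Rightarrow> real^'d^'k \<Rightarrow> ereal" where
  "reg_cols lam \<tau> U = ereal (lam * real (nnzc U)) + ind_fun (col_ball \<tau>) U"

definition reg_S :: "real \<Rightarrow> ereal^'n^'m \<Rightarrow> ereal^'n^'m \<Rightarrow> real^'n^'m \<Rightarrow> ereal" where
  "reg_S \<beta> \<kappa>1 \<kappa>2 S = ereal (\<beta> * real (norm0 S)) + ind_fun (box_set \<kappa>1 \<kappa>2) S"

definition f_J ::
    "((real^'n^'m) \<times> (real^'n^'m) \<Rightarrow> real) \<Rightarrow> real \<Rightarrow> ereal \<Rightarrow> real^'n^'m
      \<Rightarrow> (real^'d^'m) \<times> (real^'d^'n) \<Rightarrow> ereal" where
  "f_J f lam \<tau> Sb = (\<lambda>(X, Y).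
     ereal (f (X ** transpose Y, Sb)) + reg_cols lam \<tau> X + reg_cols lam \<tau> Y)"

definition f_A ::
    "((real^'n^'m) \<times> (real^'n^'m) \<Rightarrow> real) \<Rightarrow> real \<Rightarrow> ereal^'n^'m \<Rightarrow> ereal^'n^'m
      \<Rightarrow> real^'d^'m \<Rightarrow> real^'d^'n \<Rightarrow> real^'n^'m \<Rightarrow> ereal" where
  "f_A f \<beta> \<kappa>1 \<kappa>2 Xb Yb S = ereal (f (Xb ** transpose Yb, S)) + reg_S \<beta> \<kappa>1 \<kappa>2 S"

definition omega_J ::
    "((real^'n^'m) \<times> (real^'n^'m) \<Rightarrow> real) \<Rightarrow> real \<Rightarrow> ereal
      \<Rightarrow> real^'d^'m \<Rightarrow> real^'d^'n \<Rightarrow> real^'n^'m \<Rightarrow> real \<Rightarrow> real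
      \<Rightarrow> (real^'d^'m) \<times> (real^'d^'n) \<Rightarrow> ereal" where
  "omega_J f lam \<tau> Xb Yb Sb \<iota>1 \<iota>2 = (\<lambda>(X, Y).
     (let H = grad_Z f (Xb ** transpose Yb) Sb in
        reg_cols lam \<tau> X + reg_cols lam \<tau> Y +
        ereal (inner (H ** Yb) (X - Xb) + inner (transpose H ** Xb) (Y - Yb)
               + \<iota>1 / 2 * (norm (X - Xb))\<^sup>2 + \<iota>2 / 2 * (norm (Y - Yb))\<^sup>2)))"

definition omega_A ::
    "((real^'n^'m) \<times> (real^'n^'m) \<Rightarrow> real) \<Rightarrow> real \<Rightarrow> ereal^'n^'m \<Rightarrow> ereal^'n^'m
      \<Rightarrow> real^'d^'m \<Rightarrow> real^'d^'n \<Rightarrow> real^'n^'m \<Rightarrow> real \<Rightarrow> real^'n^'m \<Rightarrow> ereal" where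
  "omega_A f \<beta> \<kappa>1 \<kappa>2 Xb Yb Sb \<iota> S =
     reg_S \<beta> \<kappa>1 \<kappa>2 S +
     ereal (inner (grad_S f (Xb ** transpose Yb) Sb) (S - Sb) + \<iota> / 2 * (norm (S - Sb))\<^sup>2)"

(* One run of a backtracking inner loop that stops after l trials.  cand j is the (arbitrarily
   chosen) minimizer of the model m (\<rho> ^ (j - 1)) computed in trial j; trials 1, ..., l - 1 fail the
   sufficient decrease test for \<phi> with constant c, trial l passes it and becomes the new iterate. *)
definition backtracking ::
    "(real \<Rightarrow> 'a::real_normed_vector \<Rightarrow> ereal) \<Rightarrow> ('a \<Rightarrow> ereal) \<Rightarrow> real \<Rightarrow> real \<Rightarrow> 'a \<Rightarrow> 'a \<Rightarrow> bool" where
  "backtracking m \<phi> \<rho> c w w' \<longleftrightarrow>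
     (let decrease = (\<lambda>v. \<phi> v \<le> \<phi> w - ereal (c / 2 * (norm (v - w))\<^sup>2)) in
      \<exists>l\<ge>1. \<exists>cand :: nat \<Rightarrow> 'a.
        (\<forall>j\<in>{1..l}. is_arg_min (m (\<rho> ^ (j - 1))) (\<lambda>_. True) (cand j)) \<and>
        (\<forall>j\<in>{1..<l}. \<not> decrease (cand j)) \<and>
        decrease (cand l) \<and> w' = cand l)"

definition JA_PG_sequence ::
    "((real^'n^'m) \<times> (real^'n^'m) \<Rightarrow> real) \<Rightarrow> real \<Rightarrow> real \<Rightarrow> ereal \<Rightarrow> ereal^'n^'m \<Rightarrow> ereal^'n^'m
      \<Rightarrow> real \<Rightarrow> (nat \<Rightarrow> real) \<Rightarrow> (nat \<Rightarrow> real) \<Rightarrow> (nat \<Rightarrow> real) \<Rightarrow> (nat \<Rightarrow> real) \<Rightarrow> (nat \<Rightarrow> real)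
      \<Rightarrow> (nat \<Rightarrow> real^'d^'m) \<Rightarrow> (nat \<Rightarrow> real^'d^'n) \<Rightarrow> (nat \<Rightarrow> real^'n^'m) \<Rightarrow> bool" where
  "JA_PG_sequence f lam \<beta> \<tau> \<kappa>1 \<kappa>2 \<rho> \<iota>B1 \<iota>B2 \<iota>B c1 c2 X Y S \<longleftrightarrow>
     (X 0, Y 0, S 0) \<in> col_ball \<tau> \<times> col_ball \<tau> \<times> box_set \<kappa>1 \<kappa>2 \<and>
     (\<forall>k. backtracking
            (\<lambda>t. omega_J f lam \<tau> (X k) (Y k) (S k) (\<iota>B1 k * t) (\<iota>B2 k * t))
            (f_J f lam \<tau> (S k)) \<rho> (c1 k) (X k, Y k) (X (Suc k), Y (Suc k)) \<and>
          backtracking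
            (\<lambda>t. omega_A f \<beta> \<kappa>1 \<kappa>2 (X (Suc k)) (Y (Suc k)) (S k) (\<iota>B k * t))
            (f_A f \<beta> \<kappa>1 \<kappa>2 (X (Suc k)) (Y (Suc k))) \<rho> (c2 k) (S k) (S (Suc k)))"

end

(* Each accepted step decreases the objective by a multiple of its squared length, so steps tend to
   zero and X^(k+1) has the same cluster behaviour as X^k. Near an accumulation point the gradient is
   Lipschitz, so the backtracked scales stay bounded there. A point U supported on the nonzero columns
   of the limit X* has nnzc U <= nnzc X^(k+1) eventually, so it may be inserted into the prox
   subproblem; in the limit this gives 0 <= <G, U - X*> + M |U - X*|^2, i.e. -G is a regular normal at X*.
   For lam > 0 and tau = infinity the constraint set of X is a linear subspace, whence H Y* X*^T = 0,
   and likewise H^T X* Y*^T = 0; these two equations say that -H is normal to the manifold of matrices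
   of rank (rank X* Y*^T). *)
theory Submission
  imports Defs
begin

section \<open>Frobenius norm and the normal cone of fixed-rank matrices\<close>

text \<open>The run is not assumed bounded and the gradient is only locally Lipschitz, so there is
  no global bound on the scales: everything quantitative is confined to the late terms of one
  convergent subsequence. The counting regularizers are bounded by the number of columns or entries;
  with bounded gradients this forces a model minimizer of large scale into the Lipschitz ball,
  however far the feasible set extends. The joint model is linear in each increment, whereas the
  product also contains their cross term. That term is of second order and is charged to the
  proximal quadratic. Since the model is separable, each block can be tested with the other kept at
  its accepted value. Normality to the fixed-rank matrices is shown without tangent spaces or a
  singular value decomposition. A lower bound for \<open>A\<close> on matrices with columns in its
  row space stands in for the smallest nonzero singular value; it shows that the right factor
  \<open>W\<close> of a nearby matrix of equal rank deviates from \<open>Q\<close> at most in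
  proportion to the distance, so the pairing with the increment is quadratic.\<close>

lemma inner_matrix_mult_left:
  fixes A :: "real^'p^'m" and B :: "real^'n^'p" and C :: "real^'n^'m"
  shows "inner (A ** B) C = inner A (C ** transpose B)"
proof -
  have "inner (A ** B) C = (\<Sum>i\<in>UNIV. \<Sum>j\<in>UNIV. \<Sum>k\<in>UNIV. A$i$k * B$k$j * C$i$j)"
    by (simp add: inner_vec_def matrix_matrix_mult_def sum_distrib_right)
  also have "\<dots> = (\<Sum>i\<in>UNIV. \<Sum>k\<in>UNIV. \<Sum>j\<in>UNIV. A$i$k * B$k$j * C$i$j)"
    by (intro sum.cong refl sum.swap)
  also have "\<dots> = inner A (C ** transpose B)"
    by (simp add: inner_vec_def matrix_matrix_mult_def transpose_def sum_distrib_left mult_ac)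
  finally show ?thesis .
qed

lemma inner_transpose:
  fixes A B :: "real^'n^'m"
  shows "inner (transpose A) (transpose B) = inner A B"
  by (simp add: inner_vec_def transpose_def) (rule sum.swap)

lemma inner_matrix_mult_right:
  fixes A :: "real^'p^'m" and B :: "real^'n^'p" and C :: "real^'n^'m"
  shows "inner (A ** B) C = inner B (transpose A ** C)"
  using inner_matrix_mult_left[of "transpose B" "transpose A" "transpose C"]
  by (metis inner_transpose matrix_transpose_mul transpose_transpose)

lemma norm_transpose [simp]:
  fixes A :: "real^'n^'m"
  shows "norm (transpose A) = norm A"
  by (simp add: norm_eq_sqrt_inner inner_transpose)

lemma norm_matrix_sq:
  fixes A :: "real^'n^'m"
  shows "(norm A)\<^sup>2 = (\<Sum>i\<in>UNIV. (norm (A $ i))\<^sup>2)"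
  by (simp add: power2_norm_eq_inner inner_vec_def)

text \<open>Cauchy-Schwarz bounds each entry by a row norm times a column norm, and the double sum
  of these products factors.\<close>

lemma norm_matrix_mult_le:
  fixes A :: "real^'p^'m" and B :: "real^'n^'p"
  shows "norm (A ** B) \<le> norm A * norm B"
proof -
  have entry: "((A ** B) $ i $ j)\<^sup>2 \<le> (norm (A $ i))\<^sup>2 * (norm (transpose B $ j))\<^sup>2" for i j
  proof -
    have "(A ** B) $ i $ j = inner (A $ i) (transpose B $ j)"
      by (simp add: matrix_matrix_mult_def inner_vec_def transpose_def)
    then show ?thesis
      using Cauchy_Schwarz_ineq[of "A $ i" "transpose B $ j"] by (simp add: power2_norm_eq_inner)
  qed
  have "(norm (A ** B))\<^sup>2 = (\<Sum>i\<in>UNIV. \<Sum>j\<in>UNIV. ((A ** B) $ i $ j)\<^sup>2)"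
    unfolding power2_norm_eq_inner inner_vec_def by (simp add: power2_eq_square)
  also have "\<dots> \<le> (\<Sum>i\<in>UNIV. \<Sum>j\<in>UNIV. (norm (A $ i))\<^sup>2 * (norm (transpose B $ j))\<^sup>2)"
    by (intro sum_mono entry)
  also have "\<dots> = (norm A)\<^sup>2 * (norm (transpose B))\<^sup>2"
    by (simp only: norm_matrix_sq sum_product)
  also have "\<dots> = (norm A * norm B)\<^sup>2"
    by (simp add: power_mult_distrib)
  finally show ?thesis
    by (rule power2_le_imp_le) simp
qed

lemma matrix_mult_bilinear: "bilinear ((**) :: real^'p^'m \<Rightarrow> real^'n^'p \<Rightarrow> real^'n^'m)"
  unfolding bilinear_def
  by (intro conjI allI linearI; simp add: vec_eq_iff matrix_matrix_mult_def algebra_simps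
      sum.distrib sum_distrib_left)

interpretation matrix_mult:
  bounded_bilinear "(**) :: real^'p^'m \<Rightarrow> real^'n^'p \<Rightarrow> real^'n^'m"
  using matrix_mult_bilinear by (simp add: bilinear_conv_bounded_bilinear)

lemma bounded_linear_transpose: "bounded_linear (transpose :: real^'n^'m \<Rightarrow> real^'m^'n)"
  by (auto simp: transpose_def vec_eq_iff intro: linearI simp flip: linear_conv_bounded_linear)

lemma transpose_zero [simp]: "transpose (0 :: real^'n^'m) = 0"
  by (simp add: transpose_def vec_eq_iff)

text \<open>A quadratic bound is stronger than the little-o that the definition asks for. Both
  sources of normals below, fixed-rank matrices and limits of prox steps, deliver such a
  bound.\<close>

lemma regular_normalI:
  assumes "x \<in> C" "0 < \<delta>"
    and "\<And>y. y \<in> C \<Longrightarrow> norm (y - x) < \<delta> \<Longrightarrow> inner v (y - x) \<le> K * (norm (y - x))\<^sup>2"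
  shows "v \<in> regular_normal_cone C x"
  unfolding regular_normal_cone_def
proof (intro CollectI conjI allI impI)
  fix e :: real assume "0 < e"
  define d where "d = min \<delta> (e / (\<bar>K\<bar> + 1))"
  have "0 < d" using \<open>0 < \<delta>\<close> \<open>0 < e\<close> by (simp add: d_def add_nonneg_pos)
  moreover have "inner v (y - x) \<le> e * norm (y - x)" if "y \<in> C" "dist y x < d" for y
  proof -
    have n: "norm (y - x) < \<delta>" "norm (y - x) \<le> e / (\<bar>K\<bar> + 1)"
      using that by (auto simp: d_def dist_norm)
    have "K * norm (y - x) \<le> (\<bar>K\<bar> + 1) * norm (y - x)"
      by (intro mult_right_mono) auto
    also have "\<dots> \<le> e"
      using n(2) by (simp add: field_simps add_pos_nonneg pos_le_divide_eq)
    finally have "K * (norm (y - x))\<^sup>2 \<le> e * norm (y - x)"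
      by (simp add: power2_eq_square mult_right_mono flip: mult.assoc)
    then show ?thesis using assms(3)[OF \<open>y \<in> C\<close> n(1)] by linarith
  qed
  ultimately show "\<forall>\<^sub>F y in at x within C. inner v (y - x) \<le> e * norm (y - x)"
    unfolding eventually_at by blast
qed (fact assms)

lemma regular_normal_subset_normal: "regular_normal_cone C x \<subseteq> normal_cone C x"
proof
  fix v assume v: "v \<in> regular_normal_cone C x"
  then have "x \<in> C" by (simp add: regular_normal_cone_def)
  with v show "v \<in> normal_cone C x"
    unfolding normal_cone_def
    by (intro CollectI conjI exI[of _ "\<lambda>_. x"] exI[of _ "\<lambda>_. v"]) auto
qed

text \<open>Injectivity on the row space of \<open>A\<close>, whose dimension is
  \<open>rank A = rank Z\<close>, makes the image of that space under \<open>Z\<close> all of the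
  range of \<open>Z\<close>. So each column of \<open>Z\<close> already comes from a vector of that
  row space.\<close>

lemma matrix_eq_mult_mult_transpose:
  fixes A Z :: "real^'n^'m"
  assumes rank: "rank Z = rank A"
    and inj: "\<And>y. Z *v (transpose A *v y) = 0 \<Longrightarrow> transpose A *v y = 0"
  obtains M where "Z = Z ** (transpose A ** M)"
proof -
  let ?R = "range ((*v) (transpose A))"
  have sub: "subspace ?R"
    by (rule linear_subspace_image) (simp_all add: matrix_vector_mul_linear)
  have "dim ((*v) Z ` ?R) = dim ?R"
  proof (rule dim_image_eq)
    show "inj_on ((*v) Z) (span ?R)"
      unfolding span_eq_iff[THEN iffD2, OF sub]
      using linear_injective_on_subspace_0[OF matrix_vector_mul_linear sub, of Z] inj by blast
  qed (simp add: matrix_vector_mul_linear)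
  also have "\<dots> = dim (range ((*v) Z))"
    using rank by (metis rank_dim_range rank_transpose)
  finally have "(*v) Z ` ?R = range ((*v) Z)"
    by (intro subspace_dim_equal linear_subspace_image[OF matrix_vector_mul_linear] sub
        subspace_UNIV) auto
  then have "\<forall>x. \<exists>y. Z *v x = Z *v (transpose A *v y)"
    by (metis (no_types, lifting) imageE rangeI)
  then obtain y where y: "\<And>x. Z *v x = Z *v (transpose A *v y x)"
    by metis
  \<comment> \<open>Column \<open>j\<close> of \<open>M\<close> is the preimage parameter chosen for
    the \<open>j\<close>-th unit vector, so that \<open>Z\<close> and
    \<open>Z ** (transpose A ** M)\<close> agree on the standard basis.\<close>
  define M :: "real^'n^'m" where "M = (\<chi> i j. y (axis j 1) $ i)"
  have col: "M *v axis j 1 = y (axis j 1)" for j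
    by (simp add: M_def matrix_vector_mult_basis column_def vec_eq_iff)
  have "Z ** (transpose A ** M) *v axis j 1 = Z *v axis j 1" for j
    by (simp only: col y[symmetric] matrix_vector_mul_assoc[symmetric])
  then have "column j (Z ** (transpose A ** M)) = column j Z" for j
    by (simp add: matrix_vector_mult_basis)
  then have "Z = Z ** (transpose A ** M)"
    by (auto simp: column_def vec_eq_iff)
  then show ?thesis by (rule that)
qed

text \<open>With \<open>D = Z - A\<close>, factor \<open>A = A Q\<close> and \<open>Z = Z W\<close> where \<open>Q\<close> and \<open>W\<close> have columns in the row
  space of \<open>A\<close>. Then \<open>Q\<close> is a symmetric projection and
  \<open>\<langle>V, Z\<rangle> = \<langle>V, D W\<rangle> = \<langle>V, D (W - Q)\<rangle>\<close>, which is quadratic in \<open>D\<close>.\<close>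
lemma fixed_rank_regular_normal:
  fixes A V :: "real^'n^'m"
  assumes left: "transpose V ** A = 0" and right: "V ** transpose A = 0"
  shows "V \<in> regular_normal_cone {Z. rank Z = rank A} A"
proof -
  let ?R = "range ((**) (transpose A) :: real^'n^'m \<Rightarrow> real^'n^'n)"
  have linR: "linear ((**) (transpose A) :: real^'n^'m \<Rightarrow> real^'n^'n)"
    by (rule bounded_linear.linear) (rule matrix_mult.bounded_linear_right)
  have sub: "subspace ?R"
    by (rule linear_subspace_image[OF linR]) simp
  \<comment> \<open>\<open>A\<close> is injective on \<open>?R\<close>, because
    \<open>A ** (transpose A ** M) = 0\<close> makes the squared norm of
    \<open>transpose A ** M\<close> vanish; in finite dimension it is then bounded below
    there.\<close>
  have "\<exists>e>0. \<forall>W\<in>?R. norm (A ** W) \<ge> e * norm W"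
  proof (rule injective_imp_isometric)
    show "closed ?R" by (rule closed_subspace[OF sub])
    show "bounded_linear ((**) A :: real^'n^'n \<Rightarrow> _)"
      by (rule matrix_mult.bounded_linear_right)
    have "transpose A ** M = 0" if "A ** (transpose A ** M) = 0" for M :: "real^'n^'m"
    proof -
      have "inner (transpose A ** M) (transpose A ** M) = 0"
        unfolding inner_matrix_mult_right by (simp add: that)
      then show ?thesis by simp
    qed
    then show "\<forall>W\<in>?R. A ** W = 0 \<longrightarrow> W = 0" by auto
  qed (fact sub)
  then obtain s where "0 < s" and s: "\<And>M :: real^'n^'m. s * norm (transpose A ** M) \<le> norm (A ** (transpose A ** M))"
    by auto
  have inj: "transpose A *v y = 0"
    if "norm (Z - A) < s" "Z *v (transpose A *v y) = 0" for Z :: "real^'n^'m" and y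
  proof (rule ccontr)
    assume ne: "transpose A *v y \<noteq> 0"
    \<comment> \<open>The lower bound speaks of matrices, so the vector \<open>y\<close> is repeated
      in every column.\<close>
    define M :: "real^'n^'m" where "M = (\<chi> i j. y $ i)"
    have col: "(B ** M) $ i $ j = (B *v y) $ i" for B :: "real^'m^'k::finite" and i j
      by (simp add: M_def matrix_matrix_mult_def matrix_vector_mult_def)
    let ?W = "transpose A ** M"
    have "?W \<noteq> 0" using ne by (auto simp: vec_eq_iff col)
    have "Z ** ?W = 0"
      using that(2) by (simp add: vec_eq_iff matrix_mul_assoc col flip: matrix_vector_mul_assoc)
    then have "A ** ?W = - ((Z - A) ** ?W)"
      by (simp add: matrix_mult.diff_left)
    then have "s * norm ?W \<le> norm (Z - A) * norm ?W"
      using s[of M] norm_matrix_mult_le[of "Z - A" ?W] by simp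
    with \<open>?W \<noteq> 0\<close> that(1) show False by simp
  qed
  have fact: "\<exists>M. Z = Z ** (transpose A ** M)" if "norm (Z - A) < s" "rank Z = rank A" for Z
    using matrix_eq_mult_mult_transpose[OF that(2) inj[OF that(1)]] by blast
  obtain N where N: "A = A ** (transpose A ** N)"
    using fact[of A] \<open>0 < s\<close> by auto
  define Q where "Q = transpose A ** N"
  \<comment> \<open>Inserting \<open>A = A ** Q\<close> into
    \<open>transpose Q = transpose N ** A\<close> produces \<open>transpose Q ** Q\<close>, which is
    visibly symmetric.\<close>
  have "transpose Q = transpose N ** (A ** Q)"
    using N by (simp add: Q_def matrix_transpose_mul)
  also have "\<dots> = transpose Q ** Q"
    by (simp add: Q_def matrix_transpose_mul matrix_mul_assoc)
  finally have "transpose Q = Q"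
    by (metis matrix_transpose_mul transpose_transpose)
  have "V ** Q = 0"
    by (simp add: Q_def matrix_mul_assoc right)
  show ?thesis
  proof (rule regular_normalI)
    show "0 < s / 2" using \<open>0 < s\<close> by simp
  next
    fix Z assume Z: "Z \<in> {Z. rank Z = rank A}" "norm (Z - A) < s / 2"
    let ?D = "Z - A"
    obtain M where M: "Z = Z ** (transpose A ** M)"
      using fact[of Z] Z \<open>0 < s\<close> by auto
    define W where "W = transpose A ** M"
    have ZW: "Z = Z ** W" using M by (simp add: W_def)
    have AQ: "A = A ** Q" using N by (simp add: Q_def)
    have WQ: "W - Q = transpose A ** (M - N)"
      by (simp add: W_def Q_def matrix_mult.diff_right)
    have "A ** (W - Q) = ?D - ?D ** W"
      using ZW AQ by (simp add: matrix_mult.diff_right matrix_mult.diff_left)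
    then have "s * norm (W - Q) \<le> norm (?D - ?D ** W)"
      using s[of "M - N"] by (simp add: WQ)
    also have "\<dots> \<le> norm ?D + norm ?D * norm W"
      using norm_triangle_ineq4[of ?D "?D ** W"] norm_matrix_mult_le[of ?D W] by linarith
    also have "\<dots> \<le> norm ?D + norm ?D * (norm (W - Q) + norm Q)"
      using norm_triangle_ineq[of "W - Q" Q] by (simp add: mult_left_mono)
    \<comment> \<open>The radius \<open>s / 2\<close> pays off here: the last summand is half of the
      left side \<open>s * norm (W - Q)\<close> and is absorbed by it.\<close>
    also have "\<dots> \<le> norm ?D * (1 + norm Q) + s / 2 * norm (W - Q)"
      using mult_right_mono[OF less_imp_le[OF Z(2)], of "norm (W - Q)"] by (simp add: algebra_simps)
    finally have *: "norm (W - Q) \<le> 2 / s * (1 + norm Q) * norm ?D"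
      using \<open>0 < s\<close> by (simp add: field_simps)
    have A0: "inner V (A ** B) = 0" for B
    proof -
      have "transpose A ** V = 0"
        using left by (metis matrix_transpose_mul transpose_transpose transpose_zero)
      then show ?thesis
        by (simp add: inner_commute[of V] inner_matrix_mult_right)
    qed
    have Q0: "inner V (B ** Q) = 0" for B
      using \<open>V ** Q = 0\<close> \<open>transpose Q = Q\<close>
      by (simp add: inner_commute[of V] inner_matrix_mult_left)
    have "inner V ?D = inner V (?D ** (W - Q))"
      using A0[of Q] A0[of W] Q0[of ?D] AQ ZW
      by (simp add: inner_diff_right matrix_mult.diff_right matrix_mult.diff_left)
    also have "\<dots> \<le> norm V * norm (?D ** (W - Q))"
      by (rule norm_cauchy_schwarz)
    also have "\<dots> \<le> norm V * (norm ?D * norm (W - Q))"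
      by (intro mult_left_mono norm_matrix_mult_le) simp
    also have "\<dots> \<le> norm V * (norm ?D * (2 / s * (1 + norm Q) * norm ?D))"
      by (intro mult_left_mono *) simp_all
    finally show "inner V ?D \<le> norm V * (2 / s * (1 + norm Q)) * (norm ?D)\<^sup>2"
      by (simp add: power2_eq_square mult_ac)
  qed simp
qed

section \<open>Local descent estimates\<close>

text \<open>The algorithm uses gradients of the sections of \<open>f\<close>, while the Lipschitz
  hypothesis concerns the joint gradient; this is the bridge.\<close>

lemma grad_partial:
  fixes f :: "'a::euclidean_space \<times> 'b::euclidean_space \<Rightarrow> real"
  assumes "f differentiable (at (z, s))"
  shows "grad (\<lambda>z'. f (z', s)) z = fst (grad f (z, s))"
    and "grad (\<lambda>s'. f (z, s')) s = snd (grad f (z, s))"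
proof -
  have d: "(f has_derivative (\<lambda>h. inner h (grad f (z, s)))) (at (z, s))"
    using GDERIV_grad[OF assms] by (simp add: gderiv_def)
  have "((\<lambda>z'. f (z', s)) has_derivative (\<lambda>h. inner (h, 0) (grad f (z, s)))) (at z)"
    by (rule has_derivative_compose[where g = f and f = "\<lambda>z'. (z', s)", OF _ d])
      (auto intro!: derivative_eq_intros)
  then show "grad (\<lambda>z'. f (z', s)) z = fst (grad f (z, s))"
    by (intro grad_eqI) (simp add: gderiv_def inner_prod_def)
  have "((\<lambda>s'. f (z, s')) has_derivative (\<lambda>h. inner (0, h) (grad f (z, s)))) (at s)"
    by (rule has_derivative_compose[where g = f and f = "\<lambda>s'. (z, s')", OF _ d])
      (auto intro!: derivative_eq_intros)
  then show "grad (\<lambda>s'. f (z, s')) s = snd (grad f (z, s))"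
    by (intro grad_eqI) (simp add: gderiv_def inner_prod_def)
qed

text \<open>The mean value theorem along the segment replaces integration of the gradient, at the
  price of \<open>L\<close> where the sharp constant is \<open>L / 2\<close>.\<close>

lemma descent_lemma:
  fixes f :: "'a::euclidean_space \<Rightarrow> real"
  assumes diff: "\<And>p. f differentiable (at p)" and lip: "L-lipschitz_on A (grad f)"
    and "convex A" "x \<in> A" "y \<in> A"
  shows "f y \<le> f x + inner (grad f x) (y - x) + L * (norm (y - x))\<^sup>2"
proof -
  have seg: "closed_segment x y \<subseteq> A"
    using assms by (simp add: closed_segment_subset)
  obtain t where t: "t \<in> {0<..<1::real}"
    and eq: "f (x + 1 *\<^sub>R (y - x)) - f (x + 0 *\<^sub>R (y - x))
      = inner ((1 - 0) *\<^sub>R (y - x)) (grad f (x + t *\<^sub>R (y - x)))"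
  proof -
    have "\<exists>t\<in>{0<..<1::real}. f (x + 1 *\<^sub>R (y - x)) - f (x + 0 *\<^sub>R (y - x))
      = (\<lambda>h. inner (h *\<^sub>R (y - x)) (grad f (x + t *\<^sub>R (y - x)))) (1 - 0)"
    proof (rule mvt_simple)
      fix t :: real
      have "(f has_derivative (\<lambda>h. inner h (grad f (x + t *\<^sub>R (y - x))))) (at (x + t *\<^sub>R (y - x)))"
        using GDERIV_grad[OF diff] by (simp add: gderiv_def)
      then have "((\<lambda>t. f (x + t *\<^sub>R (y - x))) has_derivative
          (\<lambda>h. inner (h *\<^sub>R (y - x)) (grad f (x + t *\<^sub>R (y - x))))) (at t)"
        by (rule has_derivative_compose[rotated]) (auto intro!: derivative_eq_intros)
      then show "((\<lambda>t. f (x + t *\<^sub>R (y - x))) has_derivative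
          (\<lambda>h. inner (h *\<^sub>R (y - x)) (grad f (x + t *\<^sub>R (y - x))))) (at t within {0..1})"
        by (rule has_derivative_at_withinI)
    qed simp
    then show ?thesis using that by auto
  qed
  let ?u = "x + t *\<^sub>R (y - x)"
  have "?u \<in> closed_segment x y"
    using t by (auto simp: closed_segment_def algebra_simps intro!: exI[of _ t])
  then have "dist (grad f ?u) (grad f x) \<le> L * dist ?u x"
    using seg \<open>x \<in> A\<close> by (intro lipschitz_onD[OF lip]) auto
  also have "\<dots> \<le> L * norm (y - x)"
    using t lipschitz_on_nonneg[OF lip]
    by (intro mult_left_mono) (auto simp: dist_norm mult_left_le_one_le)
  finally have "norm (grad f ?u - grad f x) \<le> L * norm (y - x)"
    by (simp add: dist_norm)
  then have "inner (grad f ?u - grad f x) (y - x) \<le> L * norm (y - x) * norm (y - x)"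
    by (meson norm_cauchy_schwarz mult_right_mono norm_ge_zero order_trans)
  with eq show ?thesis
    by (simp add: inner_diff_left inner_commute power2_eq_square algebra_simps)
qed

lemma locally_lipschitz_imp_continuous:
  assumes "locally_lipschitz g"
  shows "continuous (at x) g"
proof -
  obtain u L where "u > 0" "L-lipschitz_on (ball x u) g"
    using assms unfolding locally_lipschitz_def by blast
  then show ?thesis
    using lipschitz_on_continuous_on continuous_on_eq_continuous_at[of "ball x u" g] by auto
qed

lemma local_descent_snd:
  fixes f :: "'a::euclidean_space \<times> 'b::euclidean_space \<Rightarrow> real"
  assumes diff: "\<And>p. f differentiable (at p)" and lip: "locally_lipschitz (grad f)"
  obtains e L where "0 < e" "0 \<le> L"
    "\<And>z s s'. dist (z, s) (z0, s0) < e \<Longrightarrow> dist s' s < e \<Longrightarrow>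
       f (z, s') \<le> f (z, s) + inner (snd (grad f (z, s))) (s' - s) + L * (norm (s' - s))\<^sup>2"
proof -
  obtain u L where "u > 0" and L: "L-lipschitz_on (ball (z0, s0) u) (grad f)"
    using lip unfolding locally_lipschitz_def by blast
  show ?thesis
  proof (rule that[of "u / 2" L])
    fix z s s' assume *: "dist (z, s) (z0, s0) < u / 2" "dist s' s < u / 2"
    then have near: "dist (z, s) (z0, s0) < u"
      using zero_le_dist[of "(z, s)" "(z0, s0)"] by linarith
    have "dist (z, s') (z0, s0) \<le> dist (z, s') (z, s) + dist (z, s) (z0, s0)"
      by (rule dist_triangle)
    then have "dist (z, s') (z0, s0) < u"
      using * by (simp add: dist_Pair_Pair)
    then have "f (z, s') \<le> f (z, s) + inner (grad f (z, s)) ((z, s') - (z, s)) + L * (norm ((z, s') - (z, s)))\<^sup>2"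
      using * near by (intro descent_lemma[OF diff L]) (simp_all add: dist_commute)
    then show "f (z, s') \<le> f (z, s) + inner (snd (grad f (z, s))) (s' - s) + L * (norm (s' - s))\<^sup>2"
      by (simp add: inner_prod_def norm_Pair)
  qed (use \<open>u > 0\<close> lipschitz_on_nonneg[OF L] in auto)
qed

text \<open>Paired with the gradient, the first two summands become the linear terms of
  \<open>omega_J\<close>; the third is the second-order cross term.\<close>

lemma factorization_expand:
  fixes X X' :: "real^'d^'m" and Y Y' :: "real^'d^'n"
  shows "X' ** transpose Y' - X ** transpose Y =
    (X' - X) ** transpose Y + X ** transpose (Y' - Y) + (X' - X) ** transpose (Y' - Y)"
  by (simp add: matrix_mult.diff_left matrix_mult.diff_right
      linear_diff[OF bounded_linear.linear[OF bounded_linear_transpose]])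

lemma local_descent_factors:
  fixes f :: "(real^'n^'m) \<times> 'b::euclidean_space \<Rightarrow> real"
    and X0 :: "real^'d^'m" and Y0 :: "real^'d^'n"
  assumes diff: "\<And>p. f differentiable (at p)" and lip: "locally_lipschitz (grad f)"
  obtains e L where "0 < e" "0 \<le> L"
    "\<And>X Y s X' Y' H. dist (X, Y, s) (X0, Y0, s0) < e \<Longrightarrow> dist (X', Y') (X, Y) < e \<Longrightarrow>
       H = fst (grad f (X ** transpose Y, s)) \<Longrightarrow>
       f (X' ** transpose Y', s) \<le> f (X ** transpose Y, s)
         + inner (H ** Y) (X' - X) + inner (transpose H ** X) (Y' - Y)
         + L * (norm ((X', Y') - (X, Y)))\<^sup>2"
proof -
  define p0 where "p0 = (X0 ** transpose Y0, s0)"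
  obtain u L where "u > 0" and L: "L-lipschitz_on (ball p0 u) (grad f)"
    using lip unfolding locally_lipschitz_def by blast
  have "0 \<le> L" using lipschitz_on_nonneg[OF L] .
  have "continuous (at (X0, Y0, s0)) (\<lambda>(X, Y, s). (X ** transpose Y, s))"
    unfolding case_prod_unfold
    by (intro continuous_intros matrix_mult.continuous bounded_linear.continuous[OF bounded_linear_transpose])
  then obtain e0 where "e0 > 0" and e0': "\<forall>q. dist q (X0, Y0, s0) < e0 \<longrightarrow>
      dist (case q of (X, Y, s) \<Rightarrow> (X ** transpose Y, s)) (case (X0, Y0, s0) of (X, Y, s) \<Rightarrow> (X ** transpose Y, s)) < u"
    using \<open>u > 0\<close> unfolding continuous_at_eps_delta by blast
  have e0: "dist (X ** transpose Y, s) p0 < u" if "dist (X, Y, s) (X0, Y0, s0) < e0" for X Y s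
    using e0'[rule_format, OF that] by (simp add: p0_def)
  \<comment> \<open>Half of \<open>e0\<close> keeps both the base point and the trial point where
    the product stays in the Lipschitz ball. The cap 1 gives \<open>norm X \<le> a\<close>,
    \<open>norm Y \<le> b\<close> and \<open>r \<le> 1\<close>, so that \<open>r * r \<le> r\<close>
    bounds the cross term linearly.\<close>
  define e where "e = min (e0 / 2) 1"
  define a b where "a = norm X0 + 1" and "b = norm Y0 + 1"
  \<comment> \<open>By the Lipschitz property this bounds the gradient on the whole ball around
    \<open>p0\<close>.\<close>
  define G where "G = norm (grad f p0) + L * u"
  have "0 < e" "0 \<le> G" using \<open>e0 > 0\<close> \<open>u > 0\<close> \<open>0 \<le> L\<close> by (auto simp: e_def G_def)
  have "0 \<le> a" "0 \<le> b" by (simp_all add: a_def b_def)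
  show ?thesis
  proof (rule that[of e "G + L * (b + a + 1)\<^sup>2"])
    fix X Y s X' Y' H
    assume near: "dist (X, Y, s) (X0, Y0, s0) < e" and step: "dist (X', Y') (X, Y) < e"
      and H: "H = fst (grad f (X ** transpose Y, s))"
    let ?Z = "X ** transpose Y" and ?Z' = "X' ** transpose Y'"
    define r where "r = norm ((X', Y') - (X, Y))"
    have r: "norm (X' - X) \<le> r" "norm (Y' - Y) \<le> r" "0 \<le> r" "r \<le> 1"
      using step norm_fst_le[of "X' - X" "Y' - Y"] norm_snd_le[of "Y' - Y" "X' - X"]
      by (auto simp: r_def dist_norm e_def)
    have "dist (X', Y', s) (X0, Y0, s0) \<le> dist (X', Y', s) (X, Y, s) + dist (X, Y, s) (X0, Y0, s0)"
      by (rule dist_triangle)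
    also have "dist (X', Y', s) (X, Y, s) = dist (X', Y') (X, Y)"
      by (simp add: dist_Pair_Pair)
    finally have "dist (?Z', s) p0 < u" "dist (?Z, s) p0 < u"
      using near step \<open>e0 > 0\<close> by (auto intro!: e0 simp: e_def)
    then have in_ball: "(?Z', s) \<in> ball p0 u" "(?Z, s) \<in> ball p0 u"
      by (auto simp: dist_commute)
    have "dist X X0 < 1" "dist Y Y0 < 1"
      using near dist_fst_le[of "(X, Y, s)" "(X0, Y0, s0)"]
        dist_snd_le[of "(X, Y, s)" "(X0, Y0, s0)"] dist_fst_le[of "(Y, s)" "(Y0, s0)"]
      by (auto simp: e_def)
    then have ab: "norm X \<le> a" "norm Y \<le> b"
      using norm_triangle_sub[of X X0] norm_triangle_sub[of Y Y0]
      by (auto simp: a_def b_def dist_norm)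
    have "dist (grad f (?Z, s)) (grad f p0) \<le> L * dist (?Z, s) p0"
      using in_ball \<open>u > 0\<close> by (intro lipschitz_onD[OF L]) auto
    also have "\<dots> \<le> L * u"
      using in_ball \<open>0 \<le> L\<close> by (intro mult_left_mono) (auto simp: dist_commute)
    finally have "norm (grad f (?Z, s)) \<le> G"
      using norm_triangle_sub[of "grad f (?Z, s)" "grad f p0"] by (simp add: G_def dist_norm)
    then have "norm H \<le> G"
      using norm_fst_le[of "fst (grad f (?Z, s))" "snd (grad f (?Z, s))"] by (simp add: H)
    have cross: "norm ((X' - X) ** transpose (Y' - Y)) \<le> r * r"
      using norm_matrix_mult_le[of "X' - X" "transpose (Y' - Y)"] mult_mono[OF r(1,2,3)]
      by simp
    have "inner H ((X' - X) ** transpose (Y' - Y)) \<le> G * (r * r)"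
      by (rule order_trans[OF norm_cauchy_schwarz]) (intro mult_mono \<open>norm H \<le> G\<close> cross; simp add: \<open>0 \<le> G\<close>)
    moreover have "inner H ((X' - X) ** transpose Y) = inner (H ** Y) (X' - X)"
      by (metis inner_commute inner_matrix_mult_left transpose_transpose)
    moreover have "inner H (X ** transpose (Y' - Y)) = inner (transpose H ** X) (Y' - Y)"
    proof -
      have "inner H (X ** transpose (Y' - Y)) = inner (transpose X ** H) (transpose (Y' - Y))"
        by (metis inner_commute inner_matrix_mult_right)
      also have "\<dots> = inner (transpose (transpose X ** H)) (Y' - Y)"
        by (metis inner_transpose transpose_transpose)
      finally show ?thesis
        by (simp add: matrix_transpose_mul)
    qed
    ultimately have first: "inner H (?Z' - ?Z) \<le> inner (H ** Y) (X' - X) + inner (transpose H ** X) (Y' - Y) + G * r\<^sup>2"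
      unfolding factorization_expand by (simp add: inner_add_right power2_eq_square)
    have "norm (?Z' - ?Z) \<le> norm ((X' - X) ** transpose Y) + norm (X ** transpose (Y' - Y)) + r * r"
      unfolding factorization_expand using cross by (intro norm_triangle_le add_mono norm_triangle_ineq)
    also have "\<dots> \<le> r * b + a * r + r * 1"
    proof (intro add_mono)
      show "norm ((X' - X) ** transpose Y) \<le> r * b"
        by (rule order_trans[OF norm_matrix_mult_le]) (use r ab in \<open>auto intro!: mult_mono\<close>)
      show "norm (X ** transpose (Y' - Y)) \<le> a * r"
        by (rule order_trans[OF norm_matrix_mult_le]) (use r ab \<open>0 \<le> a\<close> in \<open>auto intro!: mult_mono\<close>)
    qed (use mult_left_mono[OF r(4,3)] in simp)
    finally have "norm (?Z' - ?Z) \<le> (b + a + 1) * r"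
      by (simp add: algebra_simps)
    then have "(norm (?Z' - ?Z))\<^sup>2 \<le> ((b + a + 1) * r)\<^sup>2"
      by (intro power_mono) auto
    then have second: "L * (norm (?Z' - ?Z))\<^sup>2 \<le> L * (b + a + 1)\<^sup>2 * r\<^sup>2"
      using mult_left_mono[OF _ \<open>0 \<le> L\<close>] by (simp only: power_mult_distrib mult.assoc)
    have "f (?Z', s) \<le> f (?Z, s) + inner (grad f (?Z, s)) ((?Z', s) - (?Z, s))
        + L * (norm ((?Z', s) - (?Z, s)))\<^sup>2"
      by (intro descent_lemma[OF diff L] in_ball) simp
    then have "f (?Z', s) \<le> f (?Z, s) + inner H (?Z' - ?Z) + L * (norm (?Z' - ?Z))\<^sup>2"
      by (simp add: inner_prod_def norm_Pair H)
    then show "f (?Z', s) \<le> f (?Z, s) + inner (H ** Y) (X' - X) + inner (transpose H ** X) (Y' - Y)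
        + (G + L * (b + a + 1)\<^sup>2) * (norm ((X', Y') - (X, Y)))\<^sup>2"
      using first second unfolding r_def[symmetric] distrib_right by linarith
  qed (use \<open>0 < e\<close> \<open>0 \<le> G\<close> \<open>0 \<le> L\<close> in auto)
qed

section \<open>Backtracking\<close>

lemma backtracking_decrease:
  assumes "backtracking m \<phi> \<rho> c w w'"
  shows "\<phi> w' \<le> \<phi> w - ereal (c / 2 * (norm (w' - w))\<^sup>2)"
  using assms unfolding backtracking_def Let_def by blast

text \<open>For a step of length \<open>s \<ge> \<delta>\<close> the constant and the linear term
  are inflated by powers of \<open>s / \<delta> \<ge> 1\<close> until both are multiples of the
  square of \<open>s\<close>. Cancelling that square contradicts the size of
  \<open>t\<close>.\<close>

lemma model_minimizer_small:
  fixes w v g :: "'a::real_inner"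
  assumes "0 < lo" "0 < \<delta>" "0 \<le> B" "0 \<le> G" "norm g \<le> G"
    and model: "inner g (v - w) + t * (lo * (norm (v - w))\<^sup>2) \<le> B"
    and t: "(B / \<delta>\<^sup>2 + G / \<delta>) / lo < t"
  shows "norm (v - w) < \<delta>"
proof (rule ccontr)
  assume "\<not> norm (v - w) < \<delta>"
  then have s: "\<delta> \<le> norm (v - w)" by simp
  define s where "s = norm (v - w)"
  have "0 < s" "\<delta> \<le> s" using s \<open>0 < \<delta>\<close> by (auto simp: s_def)
  have "- (G * s) \<le> inner g (v - w)"
    using norm_cauchy_schwarz[of "- g" "v - w"] mult_right_mono[OF \<open>norm g \<le> G\<close>, of s]
    by (simp add: s_def)
  then have "t * lo * s\<^sup>2 \<le> B + G * s"
    using model by (simp add: s_def mult.assoc)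
  also have "\<dots> \<le> B * (s / \<delta>)\<^sup>2 + G * s * (s / \<delta>)"
  proof (intro add_mono)
    have "1 \<le> s / \<delta>" using \<open>\<delta> \<le> s\<close> \<open>0 < \<delta>\<close> by simp
    then show "B \<le> B * (s / \<delta>)\<^sup>2" "G * s \<le> G * s * (s / \<delta>)"
      using mult_left_mono[OF one_le_power[of "s / \<delta>" 2] \<open>0 \<le> B\<close>]
        mult_left_mono[of 1 "s / \<delta>" "G * s"] \<open>0 \<le> G\<close> \<open>0 < s\<close> by simp_all
  qed
  also have "\<dots> = (B / \<delta>\<^sup>2 + G / \<delta>) * s\<^sup>2"
    by (simp add: power_divide power2_eq_square algebra_simps)
  finally have "t * lo \<le> B / \<delta>\<^sup>2 + G / \<delta>"
    using \<open>0 < s\<close> by simp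
  with t \<open>0 < lo\<close> show False
    by (simp add: divide_less_eq)
qed

text \<open>The trial before the accepted one fails the decrease test. If its scale were large, its
  minimizer would be so close to \<open>w\<close> that the local descent estimate would force the test to pass.\<close>
lemma backtracking_scale_bounded:
  fixes g w w' :: "'a::real_inner" and lo \<delta> \<rho> L G B chi :: real
  defines "T \<equiv> max 1 (\<rho> * ((B / \<delta>\<^sup>2 + G / \<delta> + L + chi / 2) / lo + 1))"
  assumes pos: "0 < lo" "0 < \<delta>" "1 < \<rho>" "0 \<le> L" "0 \<le> G" "0 \<le> B" "0 \<le> chi"
    and bt: "backtracking m \<phi> \<rho> c w w'"
    and m: "\<And>t v. m t v = p v + ereal (inner g (v - w) + t * q v)"
    and q: "\<And>v. lo * (norm (v - w))\<^sup>2 \<le> q v" "q w = 0"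
    and \<phi>: "\<And>v. \<phi> v = ereal (h v) + p v" and p: "\<And>v. 0 \<le> p v" "p w \<le> ereal B"
    and g: "norm g \<le> G" and c: "c \<le> chi"
    and desc: "\<And>v. norm (v - w) < \<delta> \<Longrightarrow>
      h v \<le> h w + inner g (v - w) + L * (norm (v - w))\<^sup>2"
  shows "\<exists>t. 1 \<le> t \<and> t \<le> T \<and> is_arg_min (m t) (\<lambda>_. True) w'"
proof -
  \<comment> \<open>The terms with \<open>B\<close> and \<open>G\<close> force the trial into the
    ball of radius \<open>\<delta>\<close>; \<open>L + chi / 2\<close> lets the quadratic term cover
    both the descent error and the demanded decrease.\<close>
  define T0 where "T0 = (B / \<delta>\<^sup>2 + G / \<delta> + L + chi / 2) / lo + 1"
  have T_def: "T = max 1 (\<rho> * T0)" by (simp add: assms(1) T0_def)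
  obtain l cand where l: "1 \<le> l"
    and cand: "\<And>j. j \<in> {1..l} \<Longrightarrow> is_arg_min (m (\<rho> ^ (j - 1))) (\<lambda>_. True) (cand j)"
    and fail: "\<And>j. j \<in> {1..<l} \<Longrightarrow>
      \<not> \<phi> (cand j) \<le> \<phi> w - ereal (c / 2 * (norm (cand j - w))\<^sup>2)"
    and w': "w' = cand l"
    using bt unfolding backtracking_def Let_def by blast
  have "\<rho> ^ (l - 1) \<le> T"
  \<comment> \<open>Acceptance at once means scale 1, hence the \<open>max 1\<close> in
    \<open>T\<close>. Otherwise the rejected trial \<open>l - 1\<close> has scale \<open>t\<close>
    and the accepted one \<open>\<rho> * t\<close>, hence the factor \<open>\<rho>\<close>.\<close>
  proof (cases "l = 1")
    case True
    then show ?thesis by (simp add: T_def)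
  next
    case False
    define j where "j = l - 1"
    define t where "t = \<rho> ^ (j - 1)"
    define v where "v = cand j"
    have j: "j \<in> {1..<l}" "j \<in> {1..l}" "\<rho> ^ (l - 1) = \<rho> * t"
      using l False by (cases l; cases "l - 1"; simp add: j_def t_def)+
    have "1 \<le> t" using pos by (simp add: t_def)
    have "t \<le> T0"
    proof (rule ccontr)
      assume "\<not> t \<le> T0"
      then have "(B / \<delta>\<^sup>2 + G / \<delta> + L + chi / 2) / lo < t" by (simp add: T0_def)
      then have big: "B / \<delta>\<^sup>2 + G / \<delta> + L + chi / 2 < t * lo"
        using pos by (simp add: divide_less_eq)
      have "m t v \<le> m t w"
        using cand[OF j(2)] by (simp add: is_arg_min_linorder t_def v_def)
      then have model: "p v + ereal (inner g (v - w) + t * q v) \<le> p w"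
        unfolding m by (simp add: q)
      \<comment> \<open>The regularizer may be infinite. Its value at \<open>w\<close> is finite by
        hypothesis, and the model inequality passes finiteness on to \<open>v\<close>, so the rest
        is real arithmetic.\<close>
      obtain pw where pw: "p w = ereal pw" "0 \<le> pw" "pw \<le> B"
        using p(1)[of w] p(2) by (cases "p w") auto
      obtain pv where pv: "p v = ereal pv" "0 \<le> pv"
        using p(1)[of v] model pw by (cases "p v") auto
      have "t * (lo * (norm (v - w))\<^sup>2) \<le> t * q v"
        using \<open>1 \<le> t\<close> q by (intro mult_left_mono) auto
      then have model': "pv + inner g (v - w) + t * (lo * (norm (v - w))\<^sup>2) \<le> pw"
        using model pw pv by simp
      have "0 \<le> B / \<delta>\<^sup>2 + G / \<delta>" using pos by simp
      then have lo: "(L + c / 2) \<le> t * lo" using big c by simp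
      have "norm (v - w) < \<delta>"
      proof (rule model_minimizer_small)
        show "(B / \<delta>\<^sup>2 + G / \<delta>) / lo < t"
          using big pos by (simp add: divide_less_eq)
        show "inner g (v - w) + t * (lo * (norm (v - w))\<^sup>2) \<le> B"
          using model' pv pw by linarith
      qed (use pos g in auto)
      then have "h v + pv \<le> h w + pw + L * (norm (v - w))\<^sup>2 - t * lo * (norm (v - w))\<^sup>2"
        using desc model' by (simp add: mult.assoc)
          (smt (verit) desc)
      also have "\<dots> \<le> h w + pw - c / 2 * (norm (v - w))\<^sup>2"
        using mult_right_mono[OF lo, of "(norm (v - w))\<^sup>2"] by (simp add: distrib_right)
      finally have "\<phi> v \<le> \<phi> w - ereal (c / 2 * (norm (v - w))\<^sup>2)"
        by (simp add: \<phi> pw pv)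
      with fail[OF j(1)] show False by (simp add: v_def)
    qed
    then have "\<rho> * t \<le> \<rho> * T0" using pos by simp
    then show ?thesis unfolding j T_def by simp
  qed
  moreover have "1 \<le> \<rho> ^ (l - 1)" using pos by simp
  ultimately show ?thesis
    using cand[of l] l w' by auto
qed

section \<open>Limits of proximal steps\<close>

text \<open>The left side of \<open>opt\<close> tends to 0 because iterates and successors share
  their limit. The limit is taken for each fixed \<open>U\<close>, so the index from which
  \<open>opt\<close> holds may depend on \<open>U\<close>; only \<open>M\<close> must be
  uniform.\<close>

lemma prox_limit_normal:
  fixes x g :: "'a::euclidean_space"
  assumes "x \<in> C" "xs \<longlonglongrightarrow> x" "ys \<longlonglongrightarrow> x" "gs \<longlonglongrightarrow> g"
    and opt: "\<And>U. U \<in> C \<Longrightarrow> \<forall>\<^sub>F k in sequentially.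
      inner (gs k) (ys k - xs k) \<le> inner (gs k) (U - xs k) + M * (norm (U - xs k))\<^sup>2"
  shows "- g \<in> normal_cone C x"
proof -
  have "- g \<in> regular_normal_cone C x"
  proof (rule regular_normalI)
    show "(0::real) < 1" by simp
    fix U assume "U \<in> C"
    have "inner g (x - x) \<le> inner g (U - x) + M * (norm (U - x))\<^sup>2"
    proof (rule tendsto_le[OF _ _ _ opt[OF \<open>U \<in> C\<close>]])
      show "(\<lambda>k. inner (gs k) (U - xs k) + M * (norm (U - xs k))\<^sup>2)
          \<longlonglongrightarrow> inner g (U - x) + M * (norm (U - x))\<^sup>2"
        by (intro tendsto_intros assms)
      show "(\<lambda>k. inner (gs k) (ys k - xs k)) \<longlonglongrightarrow> inner g (x - x)"
        by (intro tendsto_intros assms)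
    qed simp
    then show "inner (- g) (U - x) \<le> M * (norm (U - x))\<^sup>2" by simp
  qed (fact assms)
  then show ?thesis using regular_normal_subset_normal by blast
qed

lemma eventually_norm_le:
  assumes "gs \<longlonglongrightarrow> (g :: 'a::real_normed_vector)"
  shows "\<forall>\<^sub>F k in sequentially. norm (gs k) \<le> norm g + 1"
proof -
  have "\<forall>\<^sub>F k in sequentially. norm (gs k) < norm g + 1"
    by (rule order_tendstoD(2)[OF tendsto_norm[OF assms]]) simp
  then show ?thesis by eventually_elim simp
qed

text \<open>Monotone convergence of \<open>a\<close> makes its consecutive differences vanish, and
  these dominate \<open>d\<close>.\<close>

lemma telescoping_null:
  fixes a d :: "nat \<Rightarrow> real"
  assumes "\<And>k. 0 \<le> a k" "\<And>k. 0 \<le> d k" "\<And>k. a (Suc k) + d k \<le> a k"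
  shows "d \<longlonglongrightarrow> 0"
proof -
  have "decseq a"
    using assms by (intro decseq_SucI) (metis add.commute add_increasing order_refl order_trans)
  then obtain l where l: "a \<longlonglongrightarrow> l"
    using decseq_convergent[of a 0] assms(1) by blast
  have "(\<lambda>k. a k - a (Suc k)) \<longlonglongrightarrow> l - l"
    by (intro tendsto_diff l LIMSEQ_Suc)
  then have "(\<lambda>k. a k - a (Suc k)) \<longlonglongrightarrow> 0" by simp
  then show ?thesis
  proof (rule tendsto_sandwich[rotated 2, OF tendsto_const])
    show "\<forall>\<^sub>F k in sequentially. d k \<le> a k - a (Suc k)"
      using assms(3) by (auto simp: le_diff_eq add.commute)
  qed (use assms in auto)
qed

section \<open>Regularizers, constraint sets and supports under limits\<close>

lemma reg_cols_eq:
  "reg_cols lam \<tau> U = (if U \<in> col_ball \<tau> then ereal (lam * real (nnzc U)) else \<infinity>)"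
  by (simp add: reg_cols_def ind_fun_def)

lemma reg_S_eq:
  "reg_S \<beta> \<kappa>1 \<kappa>2 S = (if S \<in> box_set \<kappa>1 \<kappa>2 then ereal (\<beta> * real (norm0 S)) else \<infinity>)"
  by (simp add: reg_S_def ind_fun_def)

lemma nnzc_le: "nnzc (U :: real^'d^'k) \<le> CARD('d)"
  unfolding nnzc_def by (rule card_mono) auto

lemma norm0_le: "norm0 (S :: real^'n^'m) \<le> CARD('m \<times> 'n)"
  unfolding norm0_def by (rule card_mono) auto

lemma tendsto_column:
  assumes "Vs \<longlonglongrightarrow> (V :: real^'d^'k)"
  shows "(\<lambda>k. column i (Vs k)) \<longlonglongrightarrow> column i V"
  unfolding column_def by (intro tendsto_vec_lambda tendsto_vec_nth assms)

lemma col_ball_limit: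
  assumes "Vs \<longlonglongrightarrow> V" "\<And>k. Vs k \<in> col_ball \<tau>"
  shows "V \<in> col_ball \<tau>"
  unfolding col_ball_def
proof (intro CollectI allI)
  fix i
  show "ereal (norm (column i V)) \<le> \<tau>"
    using assms(2) by (intro LIMSEQ_le_const2[OF tendsto_ereal[OF tendsto_norm[OF tendsto_column[OF assms(1)]]]])
      (auto simp: col_ball_def)
qed

lemma box_set_limit:
  assumes "Vs \<longlonglongrightarrow> V" "\<And>k. Vs k \<in> box_set \<kappa>1 \<kappa>2"
  shows "V \<in> box_set \<kappa>1 \<kappa>2"
  unfolding box_set_def
proof (intro CollectI allI conjI)
  fix i j
  have *: "(\<lambda>k. ereal (Vs k $ i $ j)) \<longlonglongrightarrow> ereal (V $ i $ j)"
    by (intro tendsto_ereal tendsto_vec_nth assms)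
  show "\<kappa>1 $ i $ j \<le> ereal (V $ i $ j)"
    using assms(2) by (intro LIMSEQ_le_const[OF *]) (auto simp: box_set_def)
  show "ereal (V $ i $ j) \<le> \<kappa>2 $ i $ j"
    using assms(2) by (intro LIMSEQ_le_const2[OF *]) (auto simp: box_set_def)
qed

lemma idx_cols_self:
  "U \<in> col_ball \<tau> \<Longrightarrow> U \<in> col_ball_on \<tau> (idx_cols lam U)"
  by (auto simp: col_ball_on_def idx_cols_def)

lemma idx_entries_self:
  "S \<in> box_set \<kappa>1 \<kappa>2 \<Longrightarrow> S \<in> box_set_on \<kappa>1 \<kappa>2 (idx_entries \<beta> S)"
  by (auto simp: box_set_on_def idx_entries_def)

text \<open>Nonzero columns of the limit stay nonzero along the sequence, so every point supported on
  \<open>idx_cols lam V\<close> is an admissible competitor in the prox subproblems.\<close>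
lemma eventually_nnzc_le:
  assumes "Vs \<longlonglongrightarrow> V" "0 \<le> lam" "U \<in> col_ball_on \<tau> (idx_cols lam V)"
  shows "\<forall>\<^sub>F k in sequentially. lam * real (nnzc U) \<le> lam * real (nnzc (Vs k))"
proof (cases "lam = 0")
  case False
  with assms have "lam > 0" by simp
  have "\<forall>\<^sub>F k in sequentially. \<forall>i\<in>{i. column i V \<noteq> 0}. column i (Vs k) \<noteq> 0"
    using tendsto_imp_eventually_ne[OF tendsto_column[OF assms(1)]]
    by (intro eventually_ball_finite) auto
  then show ?thesis
  proof eventually_elim
    case (elim k)
    have "nnzc U \<le> nnzc (Vs k)"
      unfolding nnzc_def
      using elim assms(3) \<open>lam > 0\<close> by (intro card_mono) (auto simp: col_ball_on_def idx_cols_def)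
    then show ?case using assms by (simp add: mult_left_mono)
  qed
qed simp

text \<open>Nonzero entries persist near the limit, as nonzero columns do. For
  \<open>\<beta> = 0\<close> the support is unrestricted, but both sides are 0.\<close>

lemma eventually_norm0_le:
  assumes "Vs \<longlonglongrightarrow> V" "0 \<le> \<beta>" "U \<in> box_set_on \<kappa>1 \<kappa>2 (idx_entries \<beta> V)"
  shows "\<forall>\<^sub>F k in sequentially. \<beta> * real (norm0 U) \<le> \<beta> * real (norm0 (Vs k))"
proof (cases "\<beta> = 0")
  case False
  with assms have "\<beta> > 0" by simp
  have "\<forall>\<^sub>F k in sequentially. \<forall>(i, j)\<in>{(i, j). V $ i $ j \<noteq> 0}. Vs k $ i $ j \<noteq> 0"
    using tendsto_imp_eventually_ne[OF tendsto_vec_nth[OF tendsto_vec_nth[OF assms(1)]]]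
    by (intro eventually_ball_finite) auto
  then show ?thesis
  proof eventually_elim
    case (elim k)
    have "norm0 U \<le> norm0 (Vs k)"
      unfolding norm0_def
      using elim assms(3) \<open>\<beta> > 0\<close>
      by (intro card_mono) (auto simp: box_set_on_def idx_entries_def)
    then show ?case using assms by (simp add: mult_left_mono)
  qed
qed simp

section \<open>From the factorized to the low-rank problem\<close>

text \<open>From any base point one can move inside \<open>C\<close> along \<open>u\<close> and
  along \<open>- u\<close>, so regular normals are orthogonal to \<open>u\<close>; orthogonality
  survives limits.\<close>

lemma normal_cone_subspace:
  fixes C :: "'a::euclidean_space set"
  assumes "subspace C" "v \<in> normal_cone C x" "u \<in> C"
  shows "inner v u = 0"
proof -
  have reg: "inner v u \<le> 0" if v: "v \<in> regular_normal_cone C x" and u: "u \<in> C" for v x u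
  proof (rule ccontr)
    assume pos: "\<not> inner v u \<le> 0"
    then have "u \<noteq> 0" by auto
    \<comment> \<open>Chosen so that \<open>e * norm u\<close> is half of \<open>inner v u\<close>;
      the point at distance \<open>d / 2\<close> along \<open>u\<close> then gives a
      contradiction.\<close>
    define e where "e = inner v u / (2 * norm u)"
    have "e > 0" using pos \<open>u \<noteq> 0\<close> by (simp add: e_def)
    then obtain d where "d > 0"
      and d: "\<And>y. y \<in> C \<Longrightarrow> y \<noteq> x \<Longrightarrow> dist y x < d \<Longrightarrow> inner v (y - x) \<le> e * norm (y - x)"
      using v unfolding regular_normal_cone_def eventually_at by blast
    define t where "t = d / (2 * norm u)"
    have "t > 0" using \<open>d > 0\<close> \<open>u \<noteq> 0\<close> by (simp add: t_def)
    have "x \<in> C" using v by (simp add: regular_normal_cone_def)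
    have "inner v ((x + t *\<^sub>R u) - x) \<le> e * norm ((x + t *\<^sub>R u) - x)"
    proof (rule d)
      show "x + t *\<^sub>R u \<in> C"
        using \<open>x \<in> C\<close> u assms(1) by (simp add: subspace_add subspace_scale)
      show "dist (x + t *\<^sub>R u) x < d"
        using \<open>d > 0\<close> \<open>u \<noteq> 0\<close> by (simp add: t_def dist_norm)
    qed (use \<open>t > 0\<close> \<open>u \<noteq> 0\<close> in auto)
    then have "t * inner v u \<le> t * (inner v u / 2)"
      using \<open>t > 0\<close> \<open>u \<noteq> 0\<close> by (simp add: e_def mult.commute)
    then show False using \<open>t > 0\<close> pos by simp
  qed
  have reg0: "inner v u = 0" if "v \<in> regular_normal_cone C x" for v x
    using reg[OF that assms(3)] reg[OF that subspace_neg[OF assms(1,3)]] by simp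
  obtain xs vs where "vs \<longlonglongrightarrow> v" "\<And>k. vs k \<in> regular_normal_cone C (xs k)"
    using assms(2) unfolding normal_cone_def by blast
  then have "(\<lambda>k. inner (vs k) u) \<longlonglongrightarrow> inner v u" "\<And>k. inner (vs k) u = 0"
    using reg0 by (auto intro!: tendsto_intros)
  then show ?thesis
    by (simp add: LIMSEQ_const_iff)
qed

lemma subspace_col_ball_on_infinity: "subspace (col_ball_on \<infinity> I)"
  by (auto simp: subspace_def col_ball_on_def col_ball_def column_def vec_eq_iff)

text \<open>The test direction is \<open>G ** transpose U ** U\<close>: its columns are images of
  those of \<open>U\<close>, so they vanish where those do, and its pairing with \<open>G\<close> is
  the squared norm of \<open>G ** transpose U\<close>.\<close>

lemma column_normal_mult_transpose:
  fixes G :: "real^'d^'k" and U :: "real^'d^'k"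
  assumes "- G \<in> normal_cone (col_ball_on \<infinity> (idx_cols lam U)) U"
  shows "G ** transpose U = 0"
proof -
  let ?B = "G ** transpose U"
  have "?B ** U \<in> col_ball_on \<infinity> (idx_cols lam U)"
  proof -
    have "column i (?B ** U) = ?B *v column i U" for i
      by (simp add: column_def matrix_matrix_mult_def matrix_vector_mult_def vec_eq_iff)
    then show ?thesis
      by (auto simp: col_ball_on_def col_ball_def idx_cols_def split: if_splits)
  qed
  from normal_cone_subspace[OF subspace_col_ball_on_infinity assms this]
  have "inner ?B ?B = 0"
    by (simp add: inner_matrix_mult_left)
  then show ?thesis by simp
qed

lemma zero_mem_translation: "0 \<in> (+) a ` A \<longleftrightarrow> - a \<in> A" for a :: "'a::ab_group_add"
  by (metis add.right_inverse image_iff minus_unique)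

lemma stationary_FB_imp_stationary_L:
  fixes X :: "real^'d^'m" and Y :: "real^'d^'n"
  assumes FB: "stationary_FB f lam \<beta> \<infinity> \<kappa>1 \<kappa>2 X Y S" and "lam > 0"
  shows "stationary_L f lam \<beta> CARD('d) \<kappa>1 \<kappa>2 (X ** transpose Y) S"
proof -
  let ?Z = "X ** transpose Y"
  define H where "H = grad_Z f ?Z S"
  have nX: "- (H ** Y) \<in> normal_cone (col_ball_on \<infinity> (idx_cols lam X)) X"
    and nY: "- (transpose H ** X) \<in> normal_cone (col_ball_on \<infinity> (idx_cols lam Y)) Y"
    and nS: "- grad_S f ?Z S \<in> normal_cone (box_set_on \<kappa>1 \<kappa>2 (idx_entries \<beta> S)) S"
    and S: "S \<in> box_set \<kappa>1 \<kappa>2"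
    using FB unfolding stationary_FB_def Let_def H_def zero_mem_translation by auto
  have rank: "rank ?Z \<le> CARD('d)"
    using rank_mul_le_left[of X "transpose Y"] rank_bound[of X] by simp
  have neg: "transpose (- H) = - transpose H"
    by (rule linear_neg[OF bounded_linear.linear[OF bounded_linear_transpose]])
  have "transpose (- H) ** ?Z = 0"
    using column_normal_mult_transpose[OF nY]
    by (simp add: neg matrix_mult.minus_left matrix_mul_assoc)
  moreover have "- H ** transpose ?Z = 0"
    using column_normal_mult_transpose[OF nX]
    by (simp add: matrix_mult.minus_left matrix_mul_assoc matrix_transpose_mul)
  ultimately have "- H \<in> regular_normal_cone {Z. rank Z = rank ?Z} ?Z"
    by (rule fixed_rank_regular_normal)
  \<comment> \<open>A positive \<open>lam\<close> cancels, and the common rank is at most the number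
    of columns of the factors, so exactly the fixed-rank set remains.\<close>
  moreover have "rank_set lam CARD('d) ?Z = {Z. rank Z = rank ?Z}"
    using \<open>lam > 0\<close> rank by (auto simp: rank_set_def)
  ultimately have "- H \<in> normal_cone (rank_set lam CARD('d) ?Z) ?Z"
    using regular_normal_subset_normal by auto
  then show ?thesis
    using S rank nS unfolding stationary_L_def H_def by simp
qed

section \<open>Convergence of JA-PG\<close>

text \<open>A run together with one subsequence \<open>r\<close> converging to the point under
  study; Lipschitz radii and scale bounds all depend on that point.\<close>

locale JA_PG_accumulation =
  fixes f :: "(real^'n^'m) \<times> (real^'n^'m) \<Rightarrow> real"
    and lam \<beta> :: real and \<tau> :: ereal and \<kappa>1 \<kappa>2 :: "ereal^'n^'m"
    and \<iota>_lo \<iota>_hi c_min c_max \<rho> :: real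
    and \<iota>B1 \<iota>B2 \<iota>B c1 c2 :: "nat \<Rightarrow> real"
    and X :: "nat \<Rightarrow> real^'d^'m" and Y :: "nat \<Rightarrow> real^'d^'n" and S :: "nat \<Rightarrow> real^'n^'m"
    and r :: "nat \<Rightarrow> nat" and Xs :: "real^'d^'m" and Ys :: "real^'d^'n" and Ss :: "real^'n^'m"
  assumes f_nonneg: "\<And>p. 0 \<le> f p"
    and f_diff: "\<And>p. f differentiable (at p)"
    and f_lip: "locally_lipschitz (grad f)"
    and lam: "0 \<le> lam" and \<beta>: "0 \<le> \<beta>"
    and params: "0 < \<iota>_lo" "0 < c_min" "1 < \<rho>"
    and \<iota>B1: "\<And>k. \<iota>B1 k \<in> {\<iota>_lo..\<iota>_hi}" and \<iota>B2: "\<And>k. \<iota>B2 k \<in> {\<iota>_lo..\<iota>_hi}"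
    and \<iota>B: "\<And>k. \<iota>B k \<in> {\<iota>_lo..\<iota>_hi}"
    and c1: "\<And>k. c1 k \<in> {c_min..c_max}" and c2: "\<And>k. c2 k \<in> {c_min..c_max}"
    and run: "JA_PG_sequence f lam \<beta> \<tau> \<kappa>1 \<kappa>2 \<rho> \<iota>B1 \<iota>B2 \<iota>B c1 c2 X Y S"
    and r: "strict_mono r"
    and X_lim: "(\<lambda>k. X (r k)) \<longlonglongrightarrow> Xs" and Y_lim: "(\<lambda>k. Y (r k)) \<longlonglongrightarrow> Ys"
    and S_lim: "(\<lambda>k. S (r k)) \<longlonglongrightarrow> Ss"
begin

section \<open>Feasibility, sufficient decrease and vanishing steps\<close>

definition "Z k = X k ** transpose (Y k)"

abbreviation "val_J A B s \<equiv> f (A ** transpose B, s) + lam * real (nnzc A) + lam * real (nnzc B)"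

lemma step_J: "backtracking
    (\<lambda>t. omega_J f lam \<tau> (X k) (Y k) (S k) (\<iota>B1 k * t) (\<iota>B2 k * t))
    (f_J f lam \<tau> (S k)) \<rho> (c1 k) (X k, Y k) (X (Suc k), Y (Suc k))"
  and step_A: "backtracking
    (\<lambda>t. omega_A f \<beta> \<kappa>1 \<kappa>2 (X (Suc k)) (Y (Suc k)) (S k) (\<iota>B k * t))
    (f_A f \<beta> \<kappa>1 \<kappa>2 (X (Suc k)) (Y (Suc k))) \<rho> (c2 k) (S k) (S (Suc k))"
  using run unfolding JA_PG_sequence_def by auto

lemma f_J_eq: "f_J f lam \<tau> s (A, B) =
    (if A \<in> col_ball \<tau> \<and> B \<in> col_ball \<tau> then ereal (val_J A B s) else \<infinity>)"
  by (simp add: f_J_def reg_cols_eq)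

lemma f_A_eq: "f_A f \<beta> \<kappa>1 \<kappa>2 A B s =
    (if s \<in> box_set \<kappa>1 \<kappa>2 then ereal (f (A ** transpose B, s) + \<beta> * real (norm0 s)) else \<infinity>)"
  by (simp add: f_A_def reg_S_eq)

text \<open>The decrease test starts from a finite value, and both objectives are infinite off the
  constraint sets, so an accepted trial must be feasible.\<close>

lemma feasible: "X k \<in> col_ball \<tau> \<and> Y k \<in> col_ball \<tau> \<and> S k \<in> box_set \<kappa>1 \<kappa>2"
proof (induction k)
  case 0
  then show ?case using run unfolding JA_PG_sequence_def by auto
next
  case (Suc k)
  then show ?case
    using backtracking_decrease[OF step_J[of k]] backtracking_decrease[OF step_A[of k]]
    by (auto simp: f_J_eq f_A_eq split: if_splits)
qed

definition "\<Delta> k = (norm ((X (Suc k), Y (Suc k)) - (X k, Y k)))\<^sup>2 + (norm (S (Suc k) - S k))\<^sup>2"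

lemma decrease_J: "val_J (X (Suc k)) (Y (Suc k)) (S k)
    + c_min / 2 * (norm ((X (Suc k), Y (Suc k)) - (X k, Y k)))\<^sup>2 \<le> val_J (X k) (Y k) (S k)"
proof -
  have "c_min / 2 * (norm ((X (Suc k), Y (Suc k)) - (X k, Y k)))\<^sup>2
      \<le> c1 k / 2 * (norm ((X (Suc k), Y (Suc k)) - (X k, Y k)))\<^sup>2"
    using c1[of k] by (intro mult_right_mono) auto
  then show ?thesis
    using backtracking_decrease[OF step_J[of k]] feasible[of k] feasible[of "Suc k"]
    by (simp add: f_J_eq)
qed

lemma decrease_A: "f (Z (Suc k), S (Suc k)) + \<beta> * real (norm0 (S (Suc k)))
    + c_min / 2 * (norm (S (Suc k) - S k))\<^sup>2 \<le> f (Z (Suc k), S k) + \<beta> * real (norm0 (S k))"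
proof -
  have "c_min / 2 * (norm (S (Suc k) - S k))\<^sup>2 \<le> c2 k / 2 * (norm (S (Suc k) - S k))\<^sup>2"
    using c2[of k] by (intro mult_right_mono) auto
  then show ?thesis
    using backtracking_decrease[OF step_A[of k]] feasible[of k] feasible[of "Suc k"]
    by (simp add: f_A_eq Z_def)
qed

lemma \<Delta>_null: "\<Delta> \<longlonglongrightarrow> 0"
proof -
  define F where "F k = val_J (X k) (Y k) (S k) + \<beta> * real (norm0 (S k))" for k
  have "(\<lambda>k. c_min / 2 * \<Delta> k) \<longlonglongrightarrow> 0"
  proof (rule telescoping_null[of F])
    fix k
    show "0 \<le> F k"
      using f_nonneg lam \<beta> by (simp add: F_def)
    show "0 \<le> c_min / 2 * \<Delta> k"
      using params by (simp add: \<Delta>_def)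
    show "F (Suc k) + c_min / 2 * \<Delta> k \<le> F k"
      using decrease_J[of k] decrease_A[of k] unfolding F_def \<Delta>_def Z_def distrib_left by linarith
  qed
  then have "(\<lambda>k. 2 / c_min * (c_min / 2 * \<Delta> k)) \<longlonglongrightarrow> 2 / c_min * 0"
    by (intro tendsto_intros)
  then show ?thesis using params by simp
qed

lemma steps_null:
  "(\<lambda>k. X (Suc k) - X k) \<longlonglongrightarrow> 0" "(\<lambda>k. Y (Suc k) - Y k) \<longlonglongrightarrow> 0" "(\<lambda>k. S (Suc k) - S k) \<longlonglongrightarrow> 0"
proof -
  have null: "(\<lambda>k. sqrt (\<Delta> k)) \<longlonglongrightarrow> 0"
    using tendsto_real_sqrt[OF \<Delta>_null] by simp
  have "norm (X (Suc k) - X k) \<le> sqrt (\<Delta> k)" "norm (Y (Suc k) - Y k) \<le> sqrt (\<Delta> k)"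
    "norm (S (Suc k) - S k) \<le> sqrt (\<Delta> k)" for k
    by (auto simp: \<Delta>_def norm_Pair intro!: real_le_rsqrt)
  note bounds = this[THEN allI, THEN always_eventually]
  show "(\<lambda>k. X (Suc k) - X k) \<longlonglongrightarrow> 0" "(\<lambda>k. Y (Suc k) - Y k) \<longlonglongrightarrow> 0"
    "(\<lambda>k. S (Suc k) - S k) \<longlonglongrightarrow> 0"
    by (rule Lim_null_comparison[OF bounds(1) null] Lim_null_comparison[OF bounds(2) null]
        Lim_null_comparison[OF bounds(3) null])+
qed

section \<open>Gradients, models and scales along the subsequence\<close>

lemma grad_Z_eq: "grad_Z f A s = fst (grad f (A, s))"
  and grad_S_eq: "grad_S f A s = snd (grad f (A, s))"
  using grad_partial[OF f_diff] by (auto simp: grad_Z_def grad_S_def)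

lemma grad_tendsto: "ps \<longlonglongrightarrow> p \<Longrightarrow> (\<lambda>k. grad f (ps k)) \<longlonglongrightarrow> grad f p"
  using locally_lipschitz_imp_continuous[OF f_lip] isCont_tendsto_compose by blast

text \<open>Brings the model into the shape required by \<open>backtracking_scale_bounded\<close>:
  the pair is one variable and the scale \<open>t\<close> multiplies the quadratic part
  only.\<close>

lemma omega_J_alt: "omega_J f lam \<tau> A B s (i1 * t) (i2 * t) v =
    (reg_cols lam \<tau> (fst v) + reg_cols lam \<tau> (snd v)) +
    ereal (inner (grad_Z f (A ** transpose B) s ** B, transpose (grad_Z f (A ** transpose B) s) ** A) (v - (A, B))
      + t * (i1 / 2 * (norm (fst v - A))\<^sup>2 + i2 / 2 * (norm (snd v - B))\<^sup>2))"
  by (cases v) (simp add: omega_J_def Let_def inner_prod_def algebra_simps)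

lemma omega_A_alt: "omega_A f \<beta> \<kappa>1 \<kappa>2 A B s (i * t) v = reg_S \<beta> \<kappa>1 \<kappa>2 v +
    ereal (inner (grad_S f (A ** transpose B) s) (v - s) + t * (i / 2 * (norm (v - s))\<^sup>2))"
  by (simp add: omega_A_def algebra_simps)

lemma next_lim: "(\<lambda>k. X (Suc (r k))) \<longlonglongrightarrow> Xs" "(\<lambda>k. Y (Suc (r k))) \<longlonglongrightarrow> Ys"
    "(\<lambda>k. S (Suc (r k))) \<longlonglongrightarrow> Ss"
proof -
  show "(\<lambda>k. X (Suc (r k))) \<longlonglongrightarrow> Xs"
    using tendsto_add[OF X_lim LIMSEQ_subseq_LIMSEQ[OF steps_null(1) r]] by (simp add: o_def)
  show "(\<lambda>k. Y (Suc (r k))) \<longlonglongrightarrow> Ys"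
    using tendsto_add[OF Y_lim LIMSEQ_subseq_LIMSEQ[OF steps_null(2) r]] by (simp add: o_def)
  show "(\<lambda>k. S (Suc (r k))) \<longlonglongrightarrow> Ss"
    using tendsto_add[OF S_lim LIMSEQ_subseq_LIMSEQ[OF steps_null(3) r]] by (simp add: o_def)
qed

definition "H k = grad_Z f (Z (r k)) (S (r k))"
definition "Hs = grad_Z f (Xs ** transpose Ys) Ss"
text \<open>The update of \<open>S\<close> linearizes at the already updated factors, hence
  \<open>Suc\<close> in the first argument only.\<close>

definition "HS k = grad_S f (Z (Suc (r k))) (S (r k))"
definition "HSs = grad_S f (Xs ** transpose Ys) Ss"

lemma Z_lim: "(\<lambda>k. Z (r k)) \<longlonglongrightarrow> Xs ** transpose Ys" "(\<lambda>k. Z (Suc (r k))) \<longlonglongrightarrow> Xs ** transpose Ys"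
  unfolding Z_def
  by (intro matrix_mult.tendsto bounded_linear.tendsto[OF bounded_linear_transpose]
      X_lim Y_lim next_lim)+

lemma H_lim: "H \<longlonglongrightarrow> Hs"
  unfolding H_def Hs_def grad_Z_eq
  by (intro tendsto_fst grad_tendsto tendsto_Pair Z_lim S_lim)

lemma HS_lim: "HS \<longlonglongrightarrow> HSs"
  unfolding HS_def HSs_def grad_S_eq
  by (intro tendsto_snd grad_tendsto tendsto_Pair Z_lim S_lim)

lemma G_lim:
  "(\<lambda>k. H k ** Y (r k)) \<longlonglongrightarrow> Hs ** Ys" "(\<lambda>k. transpose (H k) ** X (r k)) \<longlonglongrightarrow> transpose Hs ** Xs"
  by (intro matrix_mult.tendsto bounded_linear.tendsto[OF bounded_linear_transpose]
      H_lim X_lim Y_lim)+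

text \<open>A single \<open>T\<close> serves all late \<open>k\<close>, since the descent radius and
  constant, the gradient bound and the regularizer bound are all fixed by the limit point and the
  data.\<close>

lemma argmin_J: "\<exists>T. \<forall>\<^sub>F k in sequentially. \<exists>t. 1 \<le> t \<and> t \<le> T \<and>
    is_arg_min (omega_J f lam \<tau> (X (r k)) (Y (r k)) (S (r k)) (\<iota>B1 (r k) * t) (\<iota>B2 (r k) * t))
      (\<lambda>_. True) (X (Suc (r k)), Y (Suc (r k)))"
proof -
  obtain e L where "0 < e" "0 \<le> L" and
    desc: "\<And>A B s A' B' K. dist (A, B, s) (Xs, Ys, Ss) < e \<Longrightarrow> dist (A', B') (A, B) < e \<Longrightarrow>
       K = fst (grad f (A ** transpose B, s)) \<Longrightarrow>
       f (A' ** transpose B', s) \<le> f (A ** transpose B, s)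
         + inner (K ** B) (A' - A) + inner (transpose K ** A) (B' - B)
         + L * (norm ((A', B') - (A, B)))\<^sup>2"
    using local_descent_factors[OF f_diff f_lip] by metis
  let ?g = "\<lambda>k. (H k ** Y (r k), transpose (H k) ** X (r k))"
  define G where "G = norm (Hs ** Ys, transpose Hs ** Xs) + 1"
  \<comment> \<open>Each of the two factors has at most \<open>CARD('d)\<close> nonzero
    columns.\<close>
  define B where "B = lam * (2 * real CARD('d))"
  have "0 \<le> G" "0 \<le> B" "0 < \<iota>_lo / 2" "0 \<le> max 0 c_max"
    using params lam by (auto simp: G_def B_def)
  define T where "T = max 1 (\<rho> * ((B / e\<^sup>2 + G / e + L + max 0 c_max / 2) / (\<iota>_lo / 2) + 1))"
  note T = backtracking_scale_bounded[OF \<open>0 < \<iota>_lo / 2\<close> \<open>0 < e\<close> params(3) \<open>0 \<le> L\<close> \<open>0 \<le> G\<close>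
      \<open>0 \<le> B\<close> \<open>0 \<le> max 0 c_max\<close>, folded T_def]
  have near: "\<forall>\<^sub>F k in sequentially. dist (X (r k), Y (r k), S (r k)) (Xs, Ys, Ss) < e"
    by (rule tendstoD[OF tendsto_Pair[OF X_lim tendsto_Pair[OF Y_lim S_lim]] \<open>0 < e\<close>])
  have "\<forall>\<^sub>F k in sequentially. norm (?g k) \<le> G"
    unfolding G_def by (rule eventually_norm_le[OF tendsto_Pair[OF G_lim]])
  with near have "\<forall>\<^sub>F k in sequentially. \<exists>t. 1 \<le> t \<and> t \<le> T \<and>
    is_arg_min (omega_J f lam \<tau> (X (r k)) (Y (r k)) (S (r k)) (\<iota>B1 (r k) * t) (\<iota>B2 (r k) * t))
      (\<lambda>_. True) (X (Suc (r k)), Y (Suc (r k)))"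
  proof eventually_elim
    case (elim k)
    let ?A = "X (r k)" and ?B = "Y (r k)"
    show ?case
    proof (rule T[OF step_J[of "r k"]])
      show "omega_J f lam \<tau> ?A ?B (S (r k)) (\<iota>B1 (r k) * t) (\<iota>B2 (r k) * t) v =
          (reg_cols lam \<tau> (fst v) + reg_cols lam \<tau> (snd v)) + ereal (inner (?g k) (v - (?A, ?B))
          + t * (\<iota>B1 (r k) / 2 * (norm (fst v - ?A))\<^sup>2 + \<iota>B2 (r k) / 2 * (norm (snd v - ?B))\<^sup>2))" for t v
        unfolding omega_J_alt H_def Z_def ..
      show "\<iota>_lo / 2 * (norm (v - (?A, ?B)))\<^sup>2
          \<le> \<iota>B1 (r k) / 2 * (norm (fst v - ?A))\<^sup>2 + \<iota>B2 (r k) / 2 * (norm (snd v - ?B))\<^sup>2" for v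
        using \<iota>B1[of "r k"] \<iota>B2[of "r k"]
        by (cases v) (auto simp: norm_Pair distrib_left intro!: add_mono mult_right_mono)
      show "f_J f lam \<tau> (S (r k)) v = ereal (f (fst v ** transpose (snd v), S (r k))) +
          (reg_cols lam \<tau> (fst v) + reg_cols lam \<tau> (snd v))" for v
        by (cases v) (simp add: f_J_def add.assoc)
      show "0 \<le> reg_cols lam \<tau> (fst v) + reg_cols lam \<tau> (snd v)"
        for v :: "(real^'d^'m) \<times> (real^'d^'n)"
        using lam by (simp add: reg_cols_eq)
      have "lam * real (nnzc ?A) + lam * real (nnzc ?B) \<le> B"
        using lam nnzc_le[of ?A] nnzc_le[of ?B]
        unfolding B_def distrib_left[symmetric] by (intro mult_left_mono) auto
      then show "reg_cols lam \<tau> (fst (?A, ?B)) + reg_cols lam \<tau> (snd (?A, ?B)) \<le> ereal B"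
        using feasible[of "r k"] by (simp add: reg_cols_eq)
      show "c1 (r k) \<le> max 0 c_max" using c1[of "r k"] by (simp add: le_max_iff_disj)
      show "f (fst v ** transpose (snd v), S (r k))
          \<le> f (fst (?A, ?B) ** transpose (snd (?A, ?B)), S (r k)) + inner (?g k) (v - (?A, ?B))
            + L * (norm (v - (?A, ?B)))\<^sup>2" if "norm (v - (?A, ?B)) < e" for v
        using desc[OF elim(1), of "fst v" "snd v" "H k"] that
        by (cases v) (simp add: dist_norm H_def Z_def grad_Z_eq inner_prod_def add.assoc)
    qed (use elim in auto)
  qed
  then show ?thesis by blast
qed

lemma argmin_A: "\<exists>T. \<forall>\<^sub>F k in sequentially. \<exists>t. 1 \<le> t \<and> t \<le> T \<and>
    is_arg_min (omega_A f \<beta> \<kappa>1 \<kappa>2 (X (Suc (r k))) (Y (Suc (r k))) (S (r k)) (\<iota>B (r k) * t))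
      (\<lambda>_. True) (S (Suc (r k)))"
proof -
  obtain e L where "0 < e" "0 \<le> L" and
    desc: "\<And>z s s'. dist (z, s) (Xs ** transpose Ys, Ss) < e \<Longrightarrow> dist s' s < e \<Longrightarrow>
       f (z, s') \<le> f (z, s) + inner (snd (grad f (z, s))) (s' - s) + L * (norm (s' - s))\<^sup>2"
    using local_descent_snd[OF f_diff f_lip] by metis
  define G where "G = norm HSs + 1"
  define B where "B = \<beta> * real CARD('m \<times> 'n)"
  have "0 \<le> G" "0 \<le> B" "0 < \<iota>_lo / 2" "0 \<le> max 0 c_max"
    using params \<beta> by (auto simp: G_def B_def)
  define T where "T = max 1 (\<rho> * ((B / e\<^sup>2 + G / e + L + max 0 c_max / 2) / (\<iota>_lo / 2) + 1))"
  note T = backtracking_scale_bounded[OF \<open>0 < \<iota>_lo / 2\<close> \<open>0 < e\<close> params(3) \<open>0 \<le> L\<close> \<open>0 \<le> G\<close>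
      \<open>0 \<le> B\<close> \<open>0 \<le> max 0 c_max\<close>, folded T_def]
  have near: "\<forall>\<^sub>F k in sequentially. dist (Z (Suc (r k)), S (r k)) (Xs ** transpose Ys, Ss) < e"
    by (rule tendstoD[OF tendsto_Pair[OF Z_lim(2) S_lim] \<open>0 < e\<close>])
  have "\<forall>\<^sub>F k in sequentially. norm (HS k) \<le> G"
    unfolding G_def by (rule eventually_norm_le[OF HS_lim])
  with near have "\<forall>\<^sub>F k in sequentially. \<exists>t. 1 \<le> t \<and> t \<le> T \<and>
    is_arg_min (omega_A f \<beta> \<kappa>1 \<kappa>2 (X (Suc (r k))) (Y (Suc (r k))) (S (r k)) (\<iota>B (r k) * t))
      (\<lambda>_. True) (S (Suc (r k)))"
  proof eventually_elim
    case (elim k)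
    show ?case
    proof (rule T[OF step_A[of "r k"]])
      show "omega_A f \<beta> \<kappa>1 \<kappa>2 (X (Suc (r k))) (Y (Suc (r k))) (S (r k)) (\<iota>B (r k) * t) v =
          reg_S \<beta> \<kappa>1 \<kappa>2 v + ereal (inner (HS k) (v - S (r k)) + t * (\<iota>B (r k) / 2 * (norm (v - S (r k)))\<^sup>2))" for t v
        unfolding omega_A_alt HS_def Z_def ..
      show "\<iota>_lo / 2 * (norm (v - S (r k)))\<^sup>2 \<le> \<iota>B (r k) / 2 * (norm (v - S (r k)))\<^sup>2" for v
        using \<iota>B[of "r k"] by (intro mult_right_mono) auto
      show "f_A f \<beta> \<kappa>1 \<kappa>2 (X (Suc (r k))) (Y (Suc (r k))) v =
          ereal (f (Z (Suc (r k)), v)) + reg_S \<beta> \<kappa>1 \<kappa>2 v" for v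
        by (simp add: f_A_def Z_def)
      show "0 \<le> reg_S \<beta> \<kappa>1 \<kappa>2 v" for v
        using \<beta> by (simp add: reg_S_eq)
      have "\<beta> * real (norm0 (S (r k))) \<le> B"
        unfolding B_def by (intro mult_left_mono of_nat_mono norm0_le \<beta>)
      then show "reg_S \<beta> \<kappa>1 \<kappa>2 (S (r k)) \<le> ereal B"
        using feasible[of "r k"] by (simp add: reg_S_eq)
      show "c2 (r k) \<le> max 0 c_max" using c2[of "r k"] by (simp add: le_max_iff_disj)
      show "f (Z (Suc (r k)), v) \<le> f (Z (Suc (r k)), S (r k)) + inner (HS k) (v - S (r k))
          + L * (norm (v - S (r k)))\<^sup>2" if "norm (v - S (r k)) < e" for v
        using desc[OF elim(1), of v] that by (simp add: dist_norm HS_def grad_S_eq)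
    qed (use elim in auto)
  qed
  then show ?thesis by blast
qed

section \<open>Optimality conditions at the limit\<close>

lemma limit_feasible: "Xs \<in> col_ball \<tau>" "Ys \<in> col_ball \<tau>" "Ss \<in> box_set \<kappa>1 \<kappa>2"
  using col_ball_limit[OF X_lim] col_ball_limit[OF Y_lim] box_set_limit[OF S_lim] feasible by auto

text \<open>Joint minimality is tested against \<open>(U, Y (Suc (r k)))\<close> and
  \<open>(X (Suc (r k)), U)\<close>; the terms of the unchanged block cancel, leaving one inequality
  per factor.\<close>

lemma normal_X: "- (Hs ** Ys) \<in> normal_cone (col_ball_on \<tau> (idx_cols lam Xs)) Xs"
  and normal_Y: "- (transpose Hs ** Xs) \<in> normal_cone (col_ball_on \<tau> (idx_cols lam Ys)) Ys"
proof -
  obtain T where T: "\<forall>\<^sub>F k in sequentially. \<exists>t. 1 \<le> t \<and> t \<le> T \<and>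
    is_arg_min (omega_J f lam \<tau> (X (r k)) (Y (r k)) (S (r k)) (\<iota>B1 (r k) * t) (\<iota>B2 (r k) * t))
      (\<lambda>_. True) (X (Suc (r k)), Y (Suc (r k)))"
    using argmin_J by blast
  \<comment> \<open>The largest proximal weight possible with scale at most \<open>T\<close>. It
    bounds the competitor's quadratic, while that of the accepted step is nonnegative and is
    dropped.\<close>
  define M where "M = T * (\<iota>_hi / 2)"
  have le_M: "t * (i / 2 * a\<^sup>2) \<le> M * a\<^sup>2" "0 \<le> t * (i / 2 * a\<^sup>2)"
    if "1 \<le> t" "t \<le> T" "i \<in> {\<iota>_lo..\<iota>_hi}" for t i a
  proof -
    have "t * (i / 2) \<le> T * (\<iota>_hi / 2)"
      using that params by (intro mult_mono) auto
    then show "t * (i / 2 * a\<^sup>2) \<le> M * a\<^sup>2"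
      unfolding M_def mult.assoc[symmetric] by (intro mult_right_mono) auto
    show "0 \<le> t * (i / 2 * a\<^sup>2)"
      using that params by simp
  qed
  show "- (Hs ** Ys) \<in> normal_cone (col_ball_on \<tau> (idx_cols lam Xs)) Xs"
  proof (rule prox_limit_normal[OF _ X_lim next_lim(1) G_lim(1)])
    show "Xs \<in> col_ball_on \<tau> (idx_cols lam Xs)"
      by (rule idx_cols_self[OF limit_feasible(1)])
    fix U :: "real^'d^'m" assume U: "U \<in> col_ball_on \<tau> (idx_cols lam Xs)"
    show "\<forall>\<^sub>F k in sequentially. inner (H k ** Y (r k)) (X (Suc (r k)) - X (r k))
        \<le> inner (H k ** Y (r k)) (U - X (r k)) + M * (norm (U - X (r k)))\<^sup>2"
      \<comment> \<open>The competitor is compared with the minimizer \<open>X (Suc (r k))\<close>,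
        so the support comparison is made along the shifted sequence.\<close>
      using T eventually_nnzc_le[OF next_lim(1) lam U]
    proof eventually_elim
      case (elim k)
      then obtain t where t: "1 \<le> t" "t \<le> T" and
        "is_arg_min (omega_J f lam \<tau> (X (r k)) (Y (r k)) (S (r k)) (\<iota>B1 (r k) * t) (\<iota>B2 (r k) * t))
          (\<lambda>_. True) (X (Suc (r k)), Y (Suc (r k)))" by blast
      then have "omega_J f lam \<tau> (X (r k)) (Y (r k)) (S (r k)) (\<iota>B1 (r k) * t) (\<iota>B2 (r k) * t) (X (Suc (r k)), Y (Suc (r k)))
          \<le> omega_J f lam \<tau> (X (r k)) (Y (r k)) (S (r k)) (\<iota>B1 (r k) * t) (\<iota>B2 (r k) * t) (U, Y (Suc (r k)))"
        by (simp add: is_arg_min_linorder)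
      moreover have "U \<in> col_ball \<tau>" using U by (simp add: col_ball_on_def)
      ultimately show ?case
        using feasible[of "Suc (r k)"] elim(2)
          le_M(2)[OF t \<iota>B1, of "r k" "norm (X (Suc (r k)) - X (r k))"]
          le_M(1)[OF t \<iota>B1, of "r k" "norm (U - X (r k))"]
        by (simp add: omega_J_alt reg_cols_eq inner_prod_def distrib_left H_def Z_def)
    qed
  qed
  show "- (transpose Hs ** Xs) \<in> normal_cone (col_ball_on \<tau> (idx_cols lam Ys)) Ys"
  proof (rule prox_limit_normal[OF _ Y_lim next_lim(2) G_lim(2)])
    show "Ys \<in> col_ball_on \<tau> (idx_cols lam Ys)"
      by (rule idx_cols_self[OF limit_feasible(2)])
    fix U :: "real^'d^'n" assume U: "U \<in> col_ball_on \<tau> (idx_cols lam Ys)"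
    show "\<forall>\<^sub>F k in sequentially. inner (transpose (H k) ** X (r k)) (Y (Suc (r k)) - Y (r k))
        \<le> inner (transpose (H k) ** X (r k)) (U - Y (r k)) + M * (norm (U - Y (r k)))\<^sup>2"
      using T eventually_nnzc_le[OF next_lim(2) lam U]
    proof eventually_elim
      case (elim k)
      then obtain t where t: "1 \<le> t" "t \<le> T" and
        "is_arg_min (omega_J f lam \<tau> (X (r k)) (Y (r k)) (S (r k)) (\<iota>B1 (r k) * t) (\<iota>B2 (r k) * t))
          (\<lambda>_. True) (X (Suc (r k)), Y (Suc (r k)))" by blast
      then have "omega_J f lam \<tau> (X (r k)) (Y (r k)) (S (r k)) (\<iota>B1 (r k) * t) (\<iota>B2 (r k) * t) (X (Suc (r k)), Y (Suc (r k)))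
          \<le> omega_J f lam \<tau> (X (r k)) (Y (r k)) (S (r k)) (\<iota>B1 (r k) * t) (\<iota>B2 (r k) * t) (X (Suc (r k)), U)"
        by (simp add: is_arg_min_linorder)
      moreover have "U \<in> col_ball \<tau>" using U by (simp add: col_ball_on_def)
      ultimately show ?case
        using feasible[of "Suc (r k)"] elim(2)
          le_M(2)[OF t \<iota>B2, of "r k" "norm (Y (Suc (r k)) - Y (r k))"]
          le_M(1)[OF t \<iota>B2, of "r k" "norm (U - Y (r k))"]
        by (simp add: omega_J_alt reg_cols_eq inner_prod_def distrib_left H_def Z_def)
    qed
  qed
qed

lemma normal_S: "- HSs \<in> normal_cone (box_set_on \<kappa>1 \<kappa>2 (idx_entries \<beta> Ss)) Ss"
proof -
  obtain T where T: "\<forall>\<^sub>F k in sequentially. \<exists>t. 1 \<le> t \<and> t \<le> T \<and>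
    is_arg_min (omega_A f \<beta> \<kappa>1 \<kappa>2 (X (Suc (r k))) (Y (Suc (r k))) (S (r k)) (\<iota>B (r k) * t))
      (\<lambda>_. True) (S (Suc (r k)))"
    using argmin_A by blast
  define M where "M = T * (\<iota>_hi / 2)"
  show ?thesis
  proof (rule prox_limit_normal[OF _ S_lim next_lim(3) HS_lim])
    show "Ss \<in> box_set_on \<kappa>1 \<kappa>2 (idx_entries \<beta> Ss)"
      by (rule idx_entries_self[OF limit_feasible(3)])
    fix U assume U: "U \<in> box_set_on \<kappa>1 \<kappa>2 (idx_entries \<beta> Ss)"
    show "\<forall>\<^sub>F k in sequentially. inner (HS k) (S (Suc (r k)) - S (r k))
        \<le> inner (HS k) (U - S (r k)) + M * (norm (U - S (r k)))\<^sup>2"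
      using T eventually_norm0_le[OF next_lim(3) \<beta> U]
    proof eventually_elim
      case (elim k)
      let ?m = "\<lambda>t. omega_A f \<beta> \<kappa>1 \<kappa>2 (X (Suc (r k))) (Y (Suc (r k))) (S (r k)) (\<iota>B (r k) * t)"
      obtain t where t: "1 \<le> t" "t \<le> T" and "is_arg_min (?m t) (\<lambda>_. True) (S (Suc (r k)))"
        using elim by blast
      then have "?m t (S (Suc (r k))) \<le> ?m t U"
        by (simp add: is_arg_min_linorder)
      moreover have "U \<in> box_set \<kappa>1 \<kappa>2" using U by (simp add: box_set_on_def)
      moreover have "t * (\<iota>B (r k) / 2 * (norm (U - S (r k)))\<^sup>2) \<le> M * (norm (U - S (r k)))\<^sup>2"
        unfolding M_def mult.assoc[symmetric]
        using t \<iota>B[of "r k"] params by (intro mult_right_mono mult_mono) auto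
      moreover have "0 \<le> t * (\<iota>B (r k) / 2 * (norm (S (Suc (r k)) - S (r k)))\<^sup>2)"
        using t \<iota>B[of "r k"] params by simp
      ultimately show ?case
        using feasible[of "Suc (r k)"] elim(2)
        by (simp add: omega_A_alt reg_S_eq HS_def Z_def)
    qed
  qed
qed

lemma stationary: "stationary_FB f lam \<beta> \<tau> \<kappa>1 \<kappa>2 Xs Ys Ss"
  using limit_feasible normal_X normal_Y normal_S
  unfolding stationary_FB_def Let_def zero_mem_translation Hs_def HSs_def by auto

end

theorem corollary3:
  fixes f :: "(real^'n^'m) \<times> (real^'n^'m) \<Rightarrow> real"
    and lam \<beta> :: real and \<tau> :: ereal and \<kappa>1 \<kappa>2 :: "ereal^'n^'m"
    and \<iota>_lo \<iota>_hi c_min c_max \<rho> :: real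
    and \<iota>B1 \<iota>B2 \<iota>B c1 c2 :: "nat \<Rightarrow> real"
    and X :: "nat \<Rightarrow> real^'d^'m" and Y :: "nat \<Rightarrow> real^'d^'n" and S :: "nat \<Rightarrow> real^'n^'m"
  assumes "\<And>p. 0 \<le> f p"
    and "\<And>p. f differentiable (at p)"
    and "locally_lipschitz (grad f)"
    and "0 \<le> lam" and "0 \<le> \<beta>" and "0 \<le> \<tau>"
    and "\<And>i j. \<kappa>1 $ i $ j \<le> 0" and "\<And>i j. 0 \<le> \<kappa>2 $ i $ j"
    and "0 < \<iota>_lo" and "\<iota>_lo \<le> \<iota>_hi" and "0 < c_min" and "c_min \<le> c_max" and "1 < \<rho>"
    and "range \<iota>B1 \<subseteq> {\<iota>_lo..\<iota>_hi}" and "range \<iota>B2 \<subseteq> {\<iota>_lo..\<iota>_hi}" and "range \<iota>B \<subseteq> {\<iota>_lo..\<iota>_hi}"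
    and "range c1 \<subseteq> {c_min..c_max}" and "range c2 \<subseteq> {c_min..c_max}"
    and "JA_PG_sequence f lam \<beta> \<tau> \<kappa>1 \<kappa>2 \<rho> \<iota>B1 \<iota>B2 \<iota>B c1 c2 X Y S"
  shows "(\<forall>Xs Ys Ss. accumulation_point (\<lambda>k. (X k, Y k, S k)) (Xs, Ys, Ss) \<longrightarrow>
            stationary_FB f lam \<beta> \<tau> \<kappa>1 \<kappa>2 Xs Ys Ss) \<and>
         (lam > 0 \<and> \<tau> = \<infinity> \<longrightarrow>
            (\<forall>Xs Ys Ss. accumulation_point (\<lambda>k. (X k, Y k, S k)) (Xs, Ys, Ss) \<longrightarrow>
               stationary_L f lam \<beta> CARD('d) \<kappa>1 \<kappa>2 (Xs ** transpose Ys) Ss))"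
proof -
  have FB: "stationary_FB f lam \<beta> \<tau> \<kappa>1 \<kappa>2 Xs Ys Ss"
    if acc: "accumulation_point (\<lambda>k. (X k, Y k, S k)) (Xs, Ys, Ss)" for Xs Ys Ss
  proof -
    obtain r :: "nat \<Rightarrow> nat" where r: "strict_mono r"
      and lim: "(\<lambda>k. (X (r k), Y (r k), S (r k))) \<longlonglongrightarrow> (Xs, Ys, Ss)"
      using acc unfolding accumulation_point_def o_def by blast
    interpret JA_PG_accumulation f lam \<beta> \<tau> \<kappa>1 \<kappa>2 \<iota>_lo \<iota>_hi c_min c_max \<rho> \<iota>B1 \<iota>B2 \<iota>B c1 c2 X Y S r Xs Ys Ss
      using assms r tendsto_fst[OF lim] tendsto_fst[OF tendsto_snd[OF lim]]
        tendsto_snd[OF tendsto_snd[OF lim]]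
      by unfold_locales (simp_all add: image_subset_iff)
    show ?thesis by (rule stationary)
  qed
  with stationary_FB_imp_stationary_L show ?thesis by blast
qed

end
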